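(* The semilinear radial heat equation $$u_t=u_{rr}+(n-1)r^{-1}u_r+k\,u^{q+1}$$ for $u(t,r)$ has the following exact solutions, where $c$ is an arbitrary constant (each with its indicated restrictions on $q$ and $n$): (i) $u=(-kq(t+c))^{-1/q}$, for $q\neq 0$; (ii) $u=\left(\pm\sqrt{\dfrac{-k}{(n-2)(n-3)}}\left(\dfrac r2-\dfrac{(n-4)(t+c)}{r}\right)\right)^{n-2}$, for $q=\dfrac{2}{2-n}\neq -1$, $n\neq 2,3,4$; (iii) $u=\left(\pm\sqrt{k}\,\bigl(1+c(3t+r^2)\bigr)\left(\dfrac{3t}{r}+r\right)\right)^{1/2}$, for $q=-4$, $n=5/2$; (iv) $u=\pm\dfrac{5(3t+r^2)}{\bigl(r(15t+r^2)+c\sqrt r\bigr)\sqrt{-2k}}$, for $q=2$, $n=5/2$; (v) $u=\pm\dfrac{3(t+c-r^2)}{r\bigl(3(t+c)+r^2\bigr)\sqrt{-2k}}$, for $q=2$, $n=5/2$; (vi) $u=\pm\dfrac{5\bigl(3(t+c)+r^2\bigr)}{r\bigl(15(t+c)+r^2\bigr)\sqrt{-2k}}$, for $q=2$, $n=5/2$. These arise, respectively, from the following functions $(G(x,v),H(x,v))$ (for a suitable choice of signs), in the sense that $u_t=r^{p-2}G(t/r^2,u/r^p)$ and $u_r=r^{p-1}H(t/r^2,u/r^p)$ with $p=-2/q$: (i) $G=kv^{q+1}$, $H=0$; (ii) $G=\pm(4-n)\sqrt{\frac{-k(n-2)}{n-3}}\,v^{(n-3)/(n-2)}$, $H=\frac{1}{4-n}G+(2-n)v$;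 (iii) $G=\frac{3v}{3x+1}\pm\frac{3\sqrt k}{2v}$, $H=\frac23G-\frac v2$; (iv) $G=\frac{3v(1\pm\sqrt{-2k}\,v)}{3x+1}$, $H=\frac16(3x+1)G-\frac{3x-1}{3x+1}v$; (v) $G=\pm\frac34\sqrt{-2k}\left(v\mp\frac{1}{\sqrt{-2k}}\right)^2$, $H=\frac23G+v\mp\frac{2}{\sqrt{-2k}}$; (vi) $G=\pm\frac{15}{4}\sqrt{-2k}\left(v\pm\frac{1}{\sqrt{-2k}}\right)^2$, $H=\frac{2}{15}G+v\pm\frac{2}{\sqrt{-2k}}$.
   Context: Here $r>0$, $n\neq 1$ is a real constant (not necessarily an integer), $k\neq0$ and $q\neq 0$ are constants. Solutions are understood on the domains of $(t,r)$ where the displayed expressions (roots, powers, quotients) are defined and smooth. Within each pair $(G,H)$ the signs $\pm,\mp$ are correlated (all upper or all lower signs).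
   Formalization: In (i), negative values of -kq(t+c) with -1/q an even integer are excluded, as the formula fails there (q=-1/2: u_t has the wrong sign). In (ii) the sign in (G,H) is chosen on each connected part of the domain, since for even n it differs between components. *)

theory Defs
  imports "HOL-Analysis.Analysis"
begin

text \<open>
  Real powers \<open>x\<close> to the \<open>a\<close> with a real exponent: for a non-integral exponent the base has to be
  positive; for an integral exponent every base is admitted for which the integer power exists.
  This is needed since the solutions may be negative when \<open>q + 1\<close> is an integer.
  The set of bases described by \<open>rpow_defined\<close> is open, and the power is smooth on it.
\<close>

definition rpow :: "real \<Rightarrow> real \<Rightarrow> real" where
  "rpow x a = (if a \<in> \<int> then x powi \<lfloor>a\<rfloor> else x powr a)"

definition rpow_defined :: "real \<Rightarrow> real \<Rightarrow> bool" where
  "rpow_defined x a \<longleftrightarrow> 0 < x \<or> (a \<in> \<int> \<and> (x \<noteq> 0 \<or> 0 \<le> a))"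

text \<open>Classical (\<open>C\<^sup>1\<close> in \<open>t\<close>, \<open>C\<^sup>2\<close> in \<open>r\<close>) solutions on an open set \<open>D\<close> of points \<open>(t, r)\<close>.\<close>

definition radial_heat_solution ::
  "real \<Rightarrow> real \<Rightarrow> real \<Rightarrow> (real \<times> real) set \<Rightarrow> (real \<Rightarrow> real \<Rightarrow> real) \<Rightarrow> bool" where
  "radial_heat_solution n k q D u \<longleftrightarrow>
     open D \<and> (\<forall>(t, r) \<in> D. 0 < r \<and> rpow_defined (u t r) (q + 1)) \<and>
     (\<exists>ut ur urr.
        continuous_on D (\<lambda>(t, r). u t r) \<and>
        continuous_on D (\<lambda>(t, r). ut t r) \<and>
        continuous_on D (\<lambda>(t, r). ur t r) \<and>
        continuous_on D (\<lambda>(t, r). urr t r) \<and>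
        (\<forall>(t, r) \<in> D.
           ((\<lambda>t'. u t' r) has_real_derivative ut t r) (at t) \<and>
           ((\<lambda>r'. u t r') has_real_derivative ur t r) (at r) \<and>
           ((\<lambda>r'. ur t r') has_real_derivative urr t r) (at r) \<and>
           ut t r = urr t r + (n - 1) * inverse r * ur t r + k * rpow (u t r) (q + 1)))"

definition arises_from ::
  "real \<Rightarrow> (real \<times> real) set \<Rightarrow> (real \<Rightarrow> real \<Rightarrow> real)
     \<Rightarrow> (real \<Rightarrow> real \<Rightarrow> real) \<Rightarrow> (real \<Rightarrow> real \<Rightarrow> real) \<Rightarrow> bool" where
  "arises_from q D u G H \<longleftrightarrow>
     (let p = - 2 / q in
      \<forall>(t, r) \<in> D.
        ((\<lambda>t'. u t' r) has_real_derivative r powr (p - 2) * G (t / r\<^sup>2) (u t r / r powr p)) (at t) \<and>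
        ((\<lambda>r'. u t r') has_real_derivative r powr (p - 1) * H (t / r\<^sup>2) (u t r / r powr p)) (at r))"

text \<open>
  In the following, \<open>s\<close> (ranging over \<open>1\<close> and \<open>- 1\<close>) stands for the upper and the lower signs.
  The sets \<open>dom1\<close> to \<open>dom6\<close> consist of the points where the powers and quotients in \<open>u1\<close> to \<open>u6\<close>
  and the power \<open>u\<close> to the \<open>q + 1\<close> in the equation are defined; that the radicands of the constant
  square roots are nonnegative is not part of these sets.
\<close>

definition u1 :: "real \<Rightarrow> real \<Rightarrow> real \<Rightarrow> real \<Rightarrow> real \<Rightarrow> real" where
  "u1 k q c t r = rpow (- k * q * (t + c)) (- 1 / q)"

text \<open>
  The last condition excludes exactly the case of a negative base with an even exponent \<open>- 1 / q\<close>.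
  There the formula fails: for \<open>q = - 1 / 2\<close> it reads \<open>u = b\<^sup>2\<close> with \<open>b = k * (t + c) / 2\<close>, so the
  derivative is \<open>k * b\<close>, whereas \<open>k\<close> times the square root of \<open>u\<close> is \<open>k * \<bar>b\<bar>\<close>.
  For \<open>q = 1\<close> and \<open>q = - 1\<close> negative bases remain admitted.
\<close>

definition dom1 :: "real \<Rightarrow> real \<Rightarrow> real \<Rightarrow> (real \<times> real) set" where
  "dom1 k q c = {(t, r). 0 < r \<and> rpow_defined (- k * q * (t + c)) (- 1 / q) \<and>
     rpow_defined (u1 k q c t r) (q + 1) \<and> (0 < - k * q * (t + c) \<or> q \<in> \<int>)}"

definition G1 :: "real \<Rightarrow> real \<Rightarrow> real \<Rightarrow> real \<Rightarrow> real" where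
  "G1 k q x v = k * rpow v (q + 1)"

definition H1 :: "real \<Rightarrow> real \<Rightarrow> real" where
  "H1 x v = 0"

definition u2 :: "real \<Rightarrow> real \<Rightarrow> real \<Rightarrow> real \<Rightarrow> real \<Rightarrow> real \<Rightarrow> real" where
  "u2 n k s c t r =
     rpow (s * sqrt (- k / ((n - 2) * (n - 3))) * (r / 2 - (n - 4) * (t + c) / r)) (n - 2)"

definition dom2 :: "real \<Rightarrow> real \<Rightarrow> real \<Rightarrow> real \<Rightarrow> real \<Rightarrow> (real \<times> real) set" where
  "dom2 n k q s c = {(t, r). 0 < r \<and>
     rpow_defined (s * sqrt (- k / ((n - 2) * (n - 3))) * (r / 2 - (n - 4) * (t + c) / r)) (n - 2) \<and>
     rpow_defined (u2 n k s c t r) (q + 1)}"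

definition G2 :: "real \<Rightarrow> real \<Rightarrow> real \<Rightarrow> real \<Rightarrow> real \<Rightarrow> real" where
  "G2 n k s x v = s * (4 - n) * sqrt (- k * (n - 2) / (n - 3)) * rpow v ((n - 3) / (n - 2))"

definition H2 :: "real \<Rightarrow> real \<Rightarrow> real \<Rightarrow> real \<Rightarrow> real \<Rightarrow> real" where
  "H2 n k s x v = 1 / (4 - n) * G2 n k s x v + (2 - n) * v"

definition u3 :: "real \<Rightarrow> real \<Rightarrow> real \<Rightarrow> real \<Rightarrow> real \<Rightarrow> real" where
  "u3 k s c t r = rpow (s * sqrt k * (1 + c * (3 * t + r\<^sup>2)) * (3 * t / r + r)) (1 / 2)"

definition dom3 :: "real \<Rightarrow> real \<Rightarrow> real \<Rightarrow> real \<Rightarrow> (real \<times> real) set" where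
  "dom3 k q s c = {(t, r). 0 < r \<and>
     rpow_defined (s * sqrt k * (1 + c * (3 * t + r\<^sup>2)) * (3 * t / r + r)) (1 / 2) \<and>
     rpow_defined (u3 k s c t r) (q + 1)}"

definition G3 :: "real \<Rightarrow> real \<Rightarrow> real \<Rightarrow> real \<Rightarrow> real" where
  "G3 k s x v = 3 * v / (3 * x + 1) + s * (3 * sqrt k / (2 * v))"

definition H3 :: "real \<Rightarrow> real \<Rightarrow> real \<Rightarrow> real \<Rightarrow> real" where
  "H3 k s x v = 2 / 3 * G3 k s x v - v / 2"

definition u4 :: "real \<Rightarrow> real \<Rightarrow> real \<Rightarrow> real \<Rightarrow> real \<Rightarrow> real" where
  "u4 k s c t r =
     s * (5 * (3 * t + r\<^sup>2) / ((r * (15 * t + r\<^sup>2) + c * sqrt r) * sqrt (- 2 * k)))"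

definition dom4 :: "real \<Rightarrow> (real \<times> real) set" where
  "dom4 c = {(t, r). 0 < r \<and> r * (15 * t + r\<^sup>2) + c * sqrt r \<noteq> 0}"

definition G4 :: "real \<Rightarrow> real \<Rightarrow> real \<Rightarrow> real \<Rightarrow> real" where
  "G4 k s x v = 3 * v * (1 + s * sqrt (- 2 * k) * v) / (3 * x + 1)"

definition H4 :: "real \<Rightarrow> real \<Rightarrow> real \<Rightarrow> real \<Rightarrow> real" where
  "H4 k s x v = 1 / 6 * (3 * x + 1) * G4 k s x v - (3 * x - 1) / (3 * x + 1) * v"

definition u5 :: "real \<Rightarrow> real \<Rightarrow> real \<Rightarrow> real \<Rightarrow> real \<Rightarrow> real" where
  "u5 k s c t r = s * (3 * (t + c - r\<^sup>2) / (r * (3 * (t + c) + r\<^sup>2) * sqrt (- 2 * k)))"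

definition dom5 :: "real \<Rightarrow> (real \<times> real) set" where
  "dom5 c = {(t, r). 0 < r \<and> 3 * (t + c) + r\<^sup>2 \<noteq> 0}"

definition G5 :: "real \<Rightarrow> real \<Rightarrow> real \<Rightarrow> real \<Rightarrow> real" where
  "G5 k s x v = s * (3 / 4) * sqrt (- 2 * k) * (v - s * (1 / sqrt (- 2 * k)))\<^sup>2"

definition H5 :: "real \<Rightarrow> real \<Rightarrow> real \<Rightarrow> real \<Rightarrow> real" where
  "H5 k s x v = 2 / 3 * G5 k s x v + v - s * (2 / sqrt (- 2 * k))"

definition u6 :: "real \<Rightarrow> real \<Rightarrow> real \<Rightarrow> real \<Rightarrow> real \<Rightarrow> real" where
  "u6 k s c t r =
     s * (5 * (3 * (t + c) + r\<^sup>2) / (r * (15 * (t + c) + r\<^sup>2) * sqrt (- 2 * k)))"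

definition dom6 :: "real \<Rightarrow> (real \<times> real) set" where
  "dom6 c = {(t, r). 0 < r \<and> 15 * (t + c) + r\<^sup>2 \<noteq> 0}"

definition G6 :: "real \<Rightarrow> real \<Rightarrow> real \<Rightarrow> real \<Rightarrow> real" where
  "G6 k s x v = s * (15 / 4) * sqrt (- 2 * k) * (v + s * (1 / sqrt (- 2 * k)))\<^sup>2"

definition H6 :: "real \<Rightarrow> real \<Rightarrow> real \<Rightarrow> real \<Rightarrow> real" where
  "H6 k s x v = 2 / 15 * G6 k s x v + v + s * (2 / sqrt (- 2 * k))"

end

theory Submission
  imports Defs
begin

text \<open>
  All six functions come from three ways of reducing the equation, with \<open>p = - 2 / q\<close> the scaling
  exponent of \<open>u\<close>.

  A function of \<open>t\<close> alone turns the equation into the ordinary differential equation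
  \<open>u' = k u\<close> to the \<open>q + 1\<close>, which \<open>u1\<close> solves.

  For a power \<open>u = w\<close> to the \<open>p\<close> the nonlinear term is \<open>k w\<close> to the \<open>p - 2\<close>, exactly the power
  that the square of \<open>w\<^sub>r\<close> carries in \<open>u\<^sub>r\<^sub>r\<close>. Dividing by it leaves an identity of second
  degree in \<open>w\<close> and its derivatives (\<open>power_solution\<close>). The bases in \<open>u2\<close> and \<open>u3\<close> are
  Laurent polynomials in \<open>r\<close>, so that this identity is a rational one.

  For \<open>q = 2\<close> a logarithmic derivative \<open>u = \<mu> \<psi>\<^sub>r / \<psi>\<close> with \<open>k \<mu>\<^sup>2 = - 2\<close> cancels the cubic term
  against the triple pole of \<open>u\<^sub>r\<^sub>r\<close>, as in the Cole-Hopf transformation; what remains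
  holds as soon as \<open>\<psi>\<close> satisfies two linear equations (\<open>log_derivative_solution\<close>). In dimension
  \<open>5 / 2\<close> these have the solutions
  \<open>\<psi> = sqrt r * (15 (t + b) + r\<^sup>2) + c\<close>, which gives \<open>u4\<close> and, for \<open>c = 0\<close>, \<open>u6\<close>, and
  \<open>\<psi> = (3 (t + c) + r\<^sup>2) / sqrt r\<close>, which gives \<open>u5\<close>.

  The first-order equations \<open>u\<^sub>t = r\<close> to the \<open>p - 2\<close> times \<open>G\<close> and \<open>u\<^sub>r = r\<close> to the \<open>p - 1\<close>
  times \<open>H\<close> follow by comparing them with the explicit first derivatives. The sign \<open>s'\<close> in \<open>G\<close> and
  \<open>H\<close> is determined by the sign \<open>s\<close> in \<open>u\<close>: it is \<open>s\<close> for \<open>u5\<close> and \<open>- s\<close> for \<open>u3\<close>, \<open>u4\<close>, \<open>u6\<close>.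
  For \<open>u2\<close> it is \<open>s\<close> times the sign of \<open>n - 2\<close> where the base of the power is positive, and the
  opposite where the base is negative.

  Negative bases need care, since \<open>(x\<close> to the \<open>a)\<close> to the \<open>b\<close> may differ there from \<open>x\<close> to the
  \<open>a b\<close>. The domains leave few of them: for \<open>u1\<close> only if \<open>q = 1\<close> or \<open>q = - 1\<close>, where the rule for
  iterated powers still holds (\<open>rpow_rpow_reciprocal\<close>), and for \<open>u2\<close> only for even exponents \<open>n - 2\<close>,
  where the base may be replaced by its absolute value (\<open>rpow_twice\<close>).
\<close>

section \<open>Real powers with bases of either sign\<close>

lemma rpow_pos_base: "0 < x \<Longrightarrow> rpow x a = x powr a"
  by (auto simp: rpow_def powr_real_of_int' elim!: Ints_cases)

lemma rpow_of_int: "rpow x (of_int m) = x powi m"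
  by (simp add: rpow_def)

lemma rpow_numeral: "rpow x (numeral m) = x ^ numeral m"
  using rpow_of_int[of x "numeral m"] by simp

lemma rpow_minus_even:
  assumes "a = 2 * of_int m"
  shows "rpow (- x) a = rpow x a"
  using rpow_of_int[of x "2 * m"] rpow_of_int[of "- x" "2 * m"] assms by simp

text \<open>
  The power rule needs no separate treatment of base \<open>0\<close>: there the exponent is an integer
  \<open>m \<ge> 0\<close>, and for \<open>m = 0\<close> the factor \<open>a\<close> annihilates the undefined power with exponent \<open>- 1\<close>.
\<close>

lemma DERIV_rpow:
  assumes "rpow_defined x a"
  shows "((\<lambda>y. rpow y a) has_real_derivative a * rpow x (a - 1)) (at x)"
proof (cases "a \<in> \<int>")
  case True
  then obtain m where m: "a = of_int m" by (auto elim: Ints_cases)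
  have "m \<ge> 0 \<or> x \<noteq> 0" using assms m by (auto simp: rpow_defined_def)
  then have "((\<lambda>y. y powi m) has_real_derivative of_int m * x powi (m - 1) * 1) (at x)"
    by (intro DERIV_power_int DERIV_ident)
  then show ?thesis
    using rpow_of_int[of _ "m - 1"] by (simp add: m rpow_of_int)
next
  case False
  then have x: "0 < x" using assms by (auto simp: rpow_defined_def)
  have "((\<lambda>y. y powr a) has_real_derivative a * x powr (a - 1)) (at x)"
    using x by (intro has_real_derivative_powr)
  then show ?thesis using False x by (simp add: rpow_pos_base) (simp add: rpow_def)
qed

lemma DERIV_rpow_compose:
  assumes "(f has_real_derivative f') (at x)" and "rpow_defined (f x) a"
  shows "((\<lambda>y. rpow (f y) a) has_real_derivative a * rpow (f x) (a - 1) * f') (at x)"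
  using DERIV_chain2[OF DERIV_rpow[OF assms(2)] assms(1)] .

lemma continuous_on_rpow:
  fixes f :: "'a::topological_space \<Rightarrow> real"
  assumes "continuous_on S f" and "\<And>x. x \<in> S \<Longrightarrow> rpow_defined (f x) a"
  shows "continuous_on S (\<lambda>x. rpow (f x) a)"
proof (rule continuous_on_compose2[OF _ assms(1)])
  show "continuous_on {x. rpow_defined x a} (\<lambda>x. rpow x a)"
    by (auto intro!: continuous_at_imp_continuous_on DERIV_isCont DERIV_rpow)
qed (use assms(2) in auto)

lemma rpow_defined_shift:
  "rpow_defined x a \<Longrightarrow> x \<noteq> 0 \<Longrightarrow> rpow_defined x (a - of_int j)"
  by (auto simp: rpow_defined_def)

lemma rpow_diff_one:
  assumes "rpow_defined x a" and "x \<noteq> 0"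
  shows "rpow x a = x * rpow x (a - 1)"
proof (cases "0 < x")
  case True
  then show ?thesis by (simp add: rpow_pos_base powr_diff)
next
  case False
  then obtain m where m: "a = of_int m"
    using assms by (auto simp: rpow_defined_def elim: Ints_cases)
  show ?thesis
    using rpow_of_int[of x "m - 1"] assms(2)
    by (simp add: m rpow_of_int power_int_diff)
qed

lemma rpow_rpow_pos:
  assumes "0 < x" shows "rpow (rpow x a) b = rpow x (a * b)"
  using assms by (simp add: rpow_pos_base powr_powr)

lemma rpow_divide_pos:
  assumes "rpow_defined x a" and "0 < y"
  shows "rpow (x / y) a = rpow x a / rpow y a"
proof (cases "0 < x")
  case True
  then show ?thesis using assms by (simp add: rpow_pos_base powr_divide)
next
  case False
  then obtain m where "a = of_int m"
    using assms by (auto simp: rpow_defined_def elim: Ints_cases)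
  then show ?thesis by (simp add: rpow_of_int power_int_divide_distrib)
qed

lemma open_rpow_defined: "open {x. rpow_defined x a}"
proof -
  have "{x. rpow_defined x a} = {0<..} \<union> (if a \<in> \<int> then (if 0 \<le> a then UNIV else - {0}) else {})"
    by (auto simp: rpow_defined_def)
  then show ?thesis by (auto simp: open_Compl)
qed

text \<open>
  The domains of \<open>u1\<close> and \<open>u2\<close> are preimages of such sets under the base of the power; for \<open>u1\<close> with
  \<open>q\<close> not an integer, the base has to be positive in addition.
\<close>

lemma open_rpow_rpow_defined: "open {x. rpow_defined x a \<and> rpow_defined (rpow x a) b}"
proof -
  have "{x. rpow_defined x a \<and> rpow_defined (rpow x a) b}
      = {x. rpow_defined x a} \<inter> (\<lambda>x. rpow x a) -` {y. rpow_defined y b}"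
    by auto
  then show ?thesis
    using continuous_open_preimage[OF continuous_on_rpow[OF continuous_on_id, of "{x. rpow_defined x a}" a]
        open_rpow_defined open_rpow_defined[of b]]
    by simp
qed

text \<open>
  At a base that is not positive both \<open>q\<close> and \<open>- 1 / q\<close> are integers, which leaves \<open>q = 1\<close> and
  \<open>q = - 1\<close>; for these the iterated power is computed directly.
\<close>

lemma rpow_rpow_reciprocal:
  assumes "q \<noteq> 0" and "rpow_defined b (- 1 / q)" and "0 < b \<or> q \<in> \<int>"
  shows "rpow (rpow b (- 1 / q)) (q + 1) = rpow b (- 1 / q - 1)"
proof (cases "0 < b")
  case True
  have "- 1 / q * (q + 1) = - 1 / q - 1" using assms(1) by (simp add: field_simps)
  then show ?thesis using rpow_rpow_pos[OF True] by simp
next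
  case False
  then have "- 1 / q \<in> \<int>" and "q \<in> \<int>"
    using assms by (auto simp: rpow_defined_def)
  then obtain m j where mj: "- 1 / q = of_int m" "q = of_int j"
    by (metis Ints_cases)
  have "real_of_int (m * j) = - 1" using assms(1) by (simp flip: mj)
  then have "m * j = - 1" by linarith
  then have "1 = j * (- m)" by (simp add: mult.commute)
  then have "j dvd 1" by (rule dvdI)
  then have "\<bar>j\<bar> = 1" by simp
  then consider "q = 1" | "q = - 1" using mj(2) by (auto simp: abs_if split: if_splits)
  then show ?thesis
  proof cases
    case 1
    have "rpow b (- 1) = inverse b" "rpow b (- 2) = inverse (b\<^sup>2)"
      using rpow_of_int[of b "- 1"] rpow_of_int[of b "- 2"]
      by (simp_all add: power_int_minus)
    then show ?thesis using 1 by (simp add: rpow_numeral power_inverse)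
  next
    case 2
    then show ?thesis using rpow_of_int[of _ 0] by simp
  qed
qed

text \<open>
  Suppose that the base is negative with odd exponent \<open>a\<close>, or zero. Then the power is at most \<open>0\<close>,
  so \<open>q\<close> is an integer as well, and \<open>a q = - 2\<close> makes \<open>a\<close> a divisor of \<open>2\<close>. The excluded values
  of \<open>a\<close> are the divisors that could still occur.
\<close>

lemma rpow_twice_base_cases:
  assumes aq: "a * q = - 2" and "a \<noteq> 1" "a \<noteq> - 1" "a \<noteq> 2"
    and d: "rpow_defined x a" "rpow_defined (rpow x a) (q + 1)"
  shows "0 < x \<or> x < 0 \<and> (\<exists>m. a = 2 * of_int m)"
proof (rule ccontr)
  assume neg: "\<not> ?thesis"
  then obtain m where m: "a = of_int m"
    using d(1) by (auto simp: rpow_defined_def elim: Ints_cases)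
  have m0: "m \<noteq> 0" using aq m by auto
  have bad: "x = 0 \<and> 0 \<le> m \<or> x < 0 \<and> odd m"
    using neg d(1) m by (auto simp: rpow_defined_def elim: evenE)
  then have "rpow x a \<le> 0"
  proof
    assume "x < 0 \<and> odd m"
    then have "0 < (- x) powi m" by (intro zero_less_power_int) simp
    also have "\<dots> = - (x powi m)" using \<open>x < 0 \<and> odd m\<close> by simp
    finally show ?thesis by (simp add: m rpow_of_int)
  qed (use m m0 in \<open>simp add: rpow_of_int\<close>)
  then have "q + 1 \<in> \<int>" using d(2) by (auto simp: rpow_defined_def)
  then have "q \<in> \<int>" using Ints_diff[of "q + 1" 1] by simp
  then obtain j where "q = of_int j" by (auto elim: Ints_cases)
  then have "real_of_int (m * j) = - 2" using aq m by simp
  then have "m * j = - 2" by linarith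
  then have "2 = m * (- j)" by simp
  then have "m dvd 2" by (rule dvdI)
  then have "\<bar>m\<bar> \<le> 2" using zdvd_imp_le[of "\<bar>m\<bar>" 2] by simp
  then have "m = 1 \<or> m = - 1 \<or> m = 2 \<or> m = - 2" using m0 by linarith
  then show False using bad assms(2-4) m by auto
qed

text \<open>
  Even powers do not see the sign of the base, so a negative base is replaced by its opposite.
\<close>

lemma rpow_twice:
  assumes aq: "a * q = - 2" and x: "0 < x \<or> x < 0 \<and> (\<exists>m. a = 2 * of_int m)"
  shows "rpow (rpow x a) (q + 1) = rpow x (a - 2)"
proof -
  have e: "a * (q + 1) = a - 2" using aq by (simp add: algebra_simps)
  show ?thesis
  proof (cases "0 < x")
    case True
    then show ?thesis using rpow_rpow_pos e by simp
  next
    case False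
    then obtain m where x: "0 < - x" and m: "a = 2 * of_int m" using assms(2) by auto
    have m': "a - 2 = 2 * of_int (m - 1)" using m by simp
    have "rpow (rpow x a) (q + 1) = rpow (rpow (- x) a) (q + 1)"
      by (simp only: rpow_minus_even[OF m])
    also have "\<dots> = rpow (- x) (a - 2)" by (simp only: rpow_rpow_pos[OF x] e)
    finally show ?thesis by (simp only: rpow_minus_even[OF m'])
  qed
qed

section \<open>Classical solutions on open sets\<close>

lemma open_slices:
  assumes "open (D :: (real \<times> real) set)"
  shows "open {t. (t, r) \<in> D}" and "open {r. (t, r) \<in> D}"
proof -
  show "open {t. (t, r) \<in> D}"
    using open_vimage[OF assms, of "\<lambda>t. (t, r)"] by (simp add: vimage_def continuous_intros)
  show "open {r. (t, r) \<in> D}"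
    using open_vimage[OF assms, of "\<lambda>r. (t, r)"] by (simp add: vimage_def continuous_intros)
qed

lemma open_continuous_preimage_halfplane:
  fixes w :: "real \<Rightarrow> real \<Rightarrow> real"
  assumes "open S" and "continuous_on {z. 0 < snd z} (\<lambda>z. w (fst z) (snd z))"
  shows "open {(t, r). 0 < r \<and> w t r \<in> S}"
proof -
  have H: "open {z :: real \<times> real. 0 < snd z}"
    by (intro open_Collect_less continuous_intros)
  have "{(t, r). 0 < r \<and> w t r \<in> S} = {z. 0 < snd z} \<inter> (\<lambda>z. w (fst z) (snd z)) -` S"
    by auto
  then show ?thesis
    using continuous_open_preimage[OF assms(2) H assms(1)] by simp
qed

lemma radial_heat_solutionI:
  assumes "open D"
    and "\<And>t r. (t, r) \<in> D \<Longrightarrow> 0 < r \<and> rpow_defined (u t r) (q + 1)"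
    and "continuous_on D (\<lambda>z. u (fst z) (snd z))" "continuous_on D (\<lambda>z. ut (fst z) (snd z))"
      "continuous_on D (\<lambda>z. ur (fst z) (snd z))" "continuous_on D (\<lambda>z. urr (fst z) (snd z))"
    and "\<And>t r. (t, r) \<in> D \<Longrightarrow> ((\<lambda>t'. u t' r) has_real_derivative ut t r) (at t)"
      "\<And>t r. (t, r) \<in> D \<Longrightarrow> ((\<lambda>r'. u t r') has_real_derivative ur t r) (at r)"
      "\<And>t r. (t, r) \<in> D \<Longrightarrow> ((\<lambda>r'. ur t r') has_real_derivative urr t r) (at r)"
    and "\<And>t r. (t, r) \<in> D \<Longrightarrow>
       ut t r = urr t r + (n - 1) * inverse r * ur t r + k * rpow (u t r) (q + 1)"
  shows "radial_heat_solution n k q D u"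
proof -
  have "\<forall>(t, r)\<in>D. 0 < r \<and> rpow_defined (u t r) (q + 1)"
    using assms(2) by auto
  moreover have "\<forall>(t, r)\<in>D. ((\<lambda>t'. u t' r) has_real_derivative ut t r) (at t) \<and>
      ((\<lambda>r'. u t r') has_real_derivative ur t r) (at r) \<and>
      ((\<lambda>r'. ur t r') has_real_derivative urr t r) (at r) \<and>
      ut t r = urr t r + (n - 1) * inverse r * ur t r + k * rpow (u t r) (q + 1)"
    using assms(7-10) by auto
  ultimately show ?thesis
    using assms(1,3-6) unfolding radial_heat_solution_def case_prod_beta by blast
qed

text \<open>
  Derivatives are local and the domain is open, so a solution may be replaced by a formula that
  agrees with it on the domain only.
\<close>

lemma radial_heat_solution_cong:
  assumes sol: "radial_heat_solution n k q D u"
    and eq: "\<And>t r. (t, r) \<in> D \<Longrightarrow> u' t r = u t r"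
  shows "radial_heat_solution n k q D u'"
proof -
  from sol have D: "open D" by (simp add: radial_heat_solution_def)
  from sol have pos0: "\<forall>(t, r)\<in>D. 0 < r \<and> rpow_defined (u t r) (q + 1)"
    by (simp add: radial_heat_solution_def)
  from sol obtain ut ur urr where
    c: "continuous_on D (\<lambda>(t, r). u t r)" "continuous_on D (\<lambda>(t, r). ut t r)"
      "continuous_on D (\<lambda>(t, r). ur t r)" "continuous_on D (\<lambda>(t, r). urr t r)"
    and d0: "\<forall>(t, r)\<in>D.
       ((\<lambda>t'. u t' r) has_real_derivative ut t r) (at t) \<and>
       ((\<lambda>r'. u t r') has_real_derivative ur t r) (at r) \<and>
       ((\<lambda>r'. ur t r') has_real_derivative urr t r) (at r) \<and>
       ut t r = urr t r + (n - 1) * inverse r * ur t r + k * rpow (u t r) (q + 1)"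
    unfolding radial_heat_solution_def by (elim conjE exE) (rule that)
  have d: "((\<lambda>t'. u t' r) has_real_derivative ut t r) (at t)"
       "((\<lambda>r'. u t r') has_real_derivative ur t r) (at r)"
       "((\<lambda>r'. ur t r') has_real_derivative urr t r) (at r)"
       "ut t r = urr t r + (n - 1) * inverse r * ur t r + k * rpow (u t r) (q + 1)"
       "0 < r" "rpow_defined (u t r) (q + 1)" if "(t, r) \<in> D" for t r
    using bspec[OF d0 that] bspec[OF pos0 that] unfolding prod.case by blast+
  have c': "continuous_on D (\<lambda>z. u' (fst z) (snd z))"
    using c(1) by (rule continuous_on_eq) (auto simp: eq)
  have dt: "((\<lambda>t'. u' t' r) has_real_derivative ut t r) (at t)" if "(t, r) \<in> D" for t r
    by (rule has_field_derivative_transform_within_open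
          [OF d(1)[OF that] open_slices(1)[OF D, of r]]) (simp_all add: that eq)
  have dr: "((\<lambda>r'. u' t r') has_real_derivative ur t r) (at r)" if "(t, r) \<in> D" for t r
    by (rule has_field_derivative_transform_within_open
          [OF d(2)[OF that] open_slices(2)[OF D, of t]]) (simp_all add: that eq)
  have cd: "continuous_on D (\<lambda>z. ut (fst z) (snd z))" "continuous_on D (\<lambda>z. ur (fst z) (snd z))"
      "continuous_on D (\<lambda>z. urr (fst z) (snd z))"
    using c(2-4) by (simp_all add: case_prod_beta)
  have drr: "((\<lambda>r'. ur t r') has_real_derivative urr t r) (at r)" if "(t, r) \<in> D" for t r
    by (rule d(3)[OF that])
  have pos: "0 < r \<and> rpow_defined (u' t r) (q + 1)" if "(t, r) \<in> D" for t r
    using d[OF that] unfolding eq[OF that] by blast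
  have pde: "ut t r = urr t r + (n - 1) * inverse r * ur t r + k * rpow (u' t r) (q + 1)"
    if "(t, r) \<in> D" for t r
    using d[OF that] unfolding eq[OF that] by blast
  show ?thesis
    by (rule radial_heat_solutionI[OF D pos c' cd dt dr drr pde])
qed

lemma arises_fromI:
  assumes "p = - 2 / q"
    and "\<And>t r. (t, r) \<in> D \<Longrightarrow> ((\<lambda>t'. u t' r) has_real_derivative
       r powr (p - 2) * G (t / r\<^sup>2) (u t r / r powr p)) (at t)"
    and "\<And>t r. (t, r) \<in> D \<Longrightarrow> ((\<lambda>r'. u t r') has_real_derivative
       r powr (p - 1) * H (t / r\<^sup>2) (u t r / r powr p)) (at r)"
  shows "arises_from q D u G H"
  using assms(2,3) unfolding arises_from_def Let_def assms(1)[symmetric] by blast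

text \<open>
  For \<open>q = 2\<close> the scaling exponent is \<open>- 1\<close>, and all powers of \<open>r\<close> are integral.
\<close>

lemma arises_from_two_I:
  assumes "\<And>t r. (t, r) \<in> D \<Longrightarrow> 0 < r"
    and "\<And>t r. (t, r) \<in> D \<Longrightarrow> ((\<lambda>t'. u t' r) has_real_derivative
       G (t / r\<^sup>2) (r * u t r) / r ^ 3) (at t)"
    and "\<And>t r. (t, r) \<in> D \<Longrightarrow> ((\<lambda>r'. u t r') has_real_derivative
       H (t / r\<^sup>2) (r * u t r) / r\<^sup>2) (at r)"
  shows "arises_from 2 D u G H"
proof (rule arises_fromI)
  show "- 1 = - 2 / (2 :: real)" by simp
  fix t r assume z: "(t, r) \<in> D"
  note r = assms(1)[OF z]
  have p: "r powr (- 1 - 2) = 1 / r ^ 3" "r powr (- 1 - 1) = 1 / r\<^sup>2" "r powr - 1 = 1 / r"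
    using r powr_realpow[of r 3] powr_realpow[of r 2]
    by (simp_all add: powr_minus_divide)
  show "((\<lambda>t'. u t' r) has_real_derivative
      r powr (- 1 - 2) * G (t / r\<^sup>2) (u t r / r powr - 1)) (at t)"
    "((\<lambda>r'. u t r') has_real_derivative
      r powr (- 1 - 1) * H (t / r\<^sup>2) (u t r / r powr - 1)) (at r)"
    using assms(2,3)[OF z] unfolding p by (simp_all add: mult.commute)
qed

section \<open>Powers of a base function\<close>

text \<open>
  With \<open>u = w\<close> to the \<open>a\<close>, every term of the equation contains the factor \<open>w\<close> to the \<open>a - 2\<close>:
  the nonlinear one by hypothesis, the others because the derivatives of \<open>u\<close> up to order two lower
  the exponent by at most two. The last hypothesis is the equation divided by this factor.
\<close>

lemma power_solution:
  fixes w wt wr wrr :: "real \<Rightarrow> real \<Rightarrow> real"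
  assumes "open D"
    and cont: "continuous_on D (\<lambda>(t, r). w t r)" "continuous_on D (\<lambda>(t, r). wt t r)"
      "continuous_on D (\<lambda>(t, r). wr t r)" "continuous_on D (\<lambda>(t, r). wrr t r)"
    and dom: "\<And>t r. (t, r) \<in> D \<Longrightarrow> 0 < r \<and> w t r \<noteq> 0 \<and> rpow_defined (w t r) a \<and>
       rpow_defined (rpow (w t r) a) (q + 1)"
    and deriv: "\<And>t r. (t, r) \<in> D \<Longrightarrow> ((\<lambda>t'. w t' r) has_real_derivative wt t r) (at t)"
      "\<And>t r. (t, r) \<in> D \<Longrightarrow> ((\<lambda>r'. w t r') has_real_derivative wr t r) (at r)"
      "\<And>t r. (t, r) \<in> D \<Longrightarrow> ((\<lambda>r'. wr t r') has_real_derivative wrr t r) (at r)"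
    and pow: "\<And>t r. (t, r) \<in> D \<Longrightarrow> rpow (rpow (w t r) a) (q + 1) = rpow (w t r) (a - 2)"
    and eq: "\<And>t r. (t, r) \<in> D \<Longrightarrow> a * w t r * wt t r =
       a * (a - 1) * (wr t r)\<^sup>2 + a * w t r * (wrr t r + (n - 1) * inverse r * wr t r) + k"
  shows "radial_heat_solution n k q D (\<lambda>t r. rpow (w t r) a)"
proof -
  define ut where "ut t r = a * rpow (w t r) (a - 1) * wt t r" for t r
  define ur where "ur t r = a * rpow (w t r) (a - 1) * wr t r" for t r
  define urr where "urr t r = a * ((a - 1) * rpow (w t r) (a - 2) * (wr t r)\<^sup>2
    + rpow (w t r) (a - 1) * wrr t r)" for t r
  have def: "rpow_defined (w t r) (a - 1) \<and> rpow_defined (w t r) (a - 2)" if "(t, r) \<in> D" for t r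
    using dom[OF that] rpow_defined_shift[of "w t r" a 1] rpow_defined_shift[of "w t r" a 2] by simp
  have c: "continuous_on D (\<lambda>z. w (fst z) (snd z))" "continuous_on D (\<lambda>z. wt (fst z) (snd z))"
      "continuous_on D (\<lambda>z. wr (fst z) (snd z))" "continuous_on D (\<lambda>z. wrr (fst z) (snd z))"
    using cont by (simp_all add: case_prod_beta)
  have cp: "continuous_on D (\<lambda>z. rpow (w (fst z) (snd z)) a)"
    "continuous_on D (\<lambda>z. rpow (w (fst z) (snd z)) (a - 1))"
    "continuous_on D (\<lambda>z. rpow (w (fst z) (snd z)) (a - 2))"
    using dom def by (auto intro!: continuous_on_rpow c)
  have drr: "((\<lambda>r'. ur t r') has_real_derivative urr t r) (at r)" if z: "(t, r) \<in> D" for t r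
  proof -
    have "((\<lambda>r'. rpow (w t r') (a - 1)) has_real_derivative
        (a - 1) * rpow (w t r) (a - 1 - 1) * wr t r) (at r)"
      using def[OF z] by (intro DERIV_rpow_compose deriv(2)[OF z]) simp
    from DERIV_cmult[OF DERIV_mult[OF this deriv(3)[OF z]], of a] show ?thesis
      unfolding ur_def mult.assoc
      by (rule DERIV_cong) (simp add: urr_def algebra_simps power2_eq_square)
  qed
  have pde: "ut t r = urr t r + (n - 1) * inverse r * ur t r + k * rpow (rpow (w t r) a) (q + 1)"
    if z: "(t, r) \<in> D" for t r
  proof -
    have *: "rpow (w t r) (a - 1) = w t r * rpow (w t r) (a - 2)"
      using rpow_diff_one[of "w t r" "a - 1"] def[OF z] dom[OF z] by simp
    have "ut t r = rpow (w t r) (a - 2) * (a * w t r * wt t r)"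
      by (simp add: ut_def *)
    also have "\<dots> = urr t r + (n - 1) * inverse r * ur t r + k * rpow (w t r) (a - 2)"
      unfolding eq[OF z] urr_def ur_def * by (simp add: algebra_simps)
    finally show ?thesis by (simp add: pow[OF z])
  qed
  have dt: "((\<lambda>t'. rpow (w t' r) a) has_real_derivative ut t r) (at t)"
    if z: "(t, r) \<in> D" for t r
    using DERIV_rpow_compose[OF deriv(1)[OF z]] dom[OF z] by (simp add: ut_def)
  have dr: "((\<lambda>r'. rpow (w t r') a) has_real_derivative ur t r) (at r)"
    if z: "(t, r) \<in> D" for t r
    using DERIV_rpow_compose[OF deriv(2)[OF z]] dom[OF z] by (simp add: ur_def)
  have cd: "continuous_on D (\<lambda>z. ut (fst z) (snd z))" "continuous_on D (\<lambda>z. ur (fst z) (snd z))"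
      "continuous_on D (\<lambda>z. urr (fst z) (snd z))"
    unfolding ut_def ur_def urr_def by (intro continuous_intros c cp)+
  show ?thesis
    using dom
    by (intro radial_heat_solutionI[OF assms(1) _ cp(1) cd dt dr drr pde]) blast+
qed

section \<open>Logarithmic derivatives\<close>

text \<open>
  In this form of the quotient rule all repeated derivatives of \<open>\<psi>\<^sub>r / \<psi>\<close> are polynomials in the
  ratios of derivatives of \<open>\<psi>\<close> to \<open>\<psi>\<close>, without denominators to clear.
\<close>

lemma DERIV_ratio:
  fixes f g :: "real \<Rightarrow> real"
  assumes "(f has_real_derivative f') (at x)" and "(g has_real_derivative g') (at x)" and "g x \<noteq> 0"
  shows "((\<lambda>y. f y / g y) has_real_derivative f' / g x - f x / g x * (g' / g x)) (at x)"
  by (rule DERIV_cong[OF DERIV_divide[OF assms]]) (use assms(3) in \<open>simp add: field_simps\<close>)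

text \<open>
  Write \<open>a\<close> for \<open>\<psi>\<^sub>r / \<psi>\<close> and \<open>b\<close> for \<open>\<psi>\<^sub>r\<^sub>r / \<psi>\<close>. The second derivative of \<open>a\<close> contains
  \<open>2 a\<^sup>3\<close>, which the choice of \<open>\<mu>\<close> cancels against the cubic term. It also contains \<open>- 3 a b\<close>, which is
  why the diffusion coefficient in the equation for \<open>\<psi>\<^sub>t\<close> is \<open>3\<close>, while it is \<open>1\<close> in the one for \<open>\<psi>\<^sub>r\<^sub>t\<close>.
  A common multiplier \<open>m\<close> is harmless: its contributions to \<open>\<psi>\<^sub>r\<^sub>t / \<psi>\<close> and to
  \<open>a \<psi>\<^sub>t / \<psi>\<close> coincide.
\<close>

lemma log_derivative_solution:
  fixes \<psi> \<psi>t \<psi>r \<psi>rr \<psi>rrr \<psi>rt m :: "real \<Rightarrow> real \<Rightarrow> real"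
  assumes "open D" and amplitude: "k * \<mu>\<^sup>2 = - 2"
    and cont: "continuous_on D (\<lambda>(t, r). \<psi> t r)" "continuous_on D (\<lambda>(t, r). \<psi>t t r)"
      "continuous_on D (\<lambda>(t, r). \<psi>r t r)" "continuous_on D (\<lambda>(t, r). \<psi>rr t r)"
      "continuous_on D (\<lambda>(t, r). \<psi>rrr t r)" "continuous_on D (\<lambda>(t, r). \<psi>rt t r)"
    and dom: "\<And>t r. (t, r) \<in> D \<Longrightarrow> 0 < r \<and> \<psi> t r \<noteq> 0"
    and deriv: "\<And>t r. (t, r) \<in> D \<Longrightarrow> ((\<lambda>t'. \<psi> t' r) has_real_derivative \<psi>t t r) (at t)"
      "\<And>t r. (t, r) \<in> D \<Longrightarrow> ((\<lambda>r'. \<psi> t r') has_real_derivative \<psi>r t r) (at r)"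
      "\<And>t r. (t, r) \<in> D \<Longrightarrow> ((\<lambda>r'. \<psi>r t r') has_real_derivative \<psi>rr t r) (at r)"
      "\<And>t r. (t, r) \<in> D \<Longrightarrow> ((\<lambda>r'. \<psi>rr t r') has_real_derivative \<psi>rrr t r) (at r)"
      "\<And>t r. (t, r) \<in> D \<Longrightarrow> ((\<lambda>t'. \<psi>r t' r) has_real_derivative \<psi>rt t r) (at t)"
    and linear: "\<And>t r. (t, r) \<in> D \<Longrightarrow>
        \<psi>t t r = 3 * \<psi>rr t r + (n - 1) * inverse r * \<psi>r t r + m t r * \<psi> t r"
      "\<And>t r. (t, r) \<in> D \<Longrightarrow>
        \<psi>rt t r = \<psi>rrr t r + (n - 1) * inverse r * \<psi>rr t r + m t r * \<psi>r t r"
  shows "radial_heat_solution n k 2 D (\<lambda>t r. \<mu> * \<psi>r t r / \<psi> t r)"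
proof -
  define ut where "ut t r = \<mu> * (\<psi>rt t r / \<psi> t r - \<psi>r t r / \<psi> t r * (\<psi>t t r / \<psi> t r))" for t r
  define ur where "ur t r = \<mu> * (\<psi>rr t r / \<psi> t r - (\<psi>r t r / \<psi> t r)\<^sup>2)" for t r
  define urr where "urr t r = \<mu> * (\<psi>rrr t r / \<psi> t r - 3 * (\<psi>r t r / \<psi> t r) * (\<psi>rr t r / \<psi> t r)
    + 2 * (\<psi>r t r / \<psi> t r) ^ 3)" for t r
  have c: "continuous_on D (\<lambda>z. \<psi> (fst z) (snd z))" "continuous_on D (\<lambda>z. \<psi>t (fst z) (snd z))"
      "continuous_on D (\<lambda>z. \<psi>r (fst z) (snd z))" "continuous_on D (\<lambda>z. \<psi>rr (fst z) (snd z))"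
      "continuous_on D (\<lambda>z. \<psi>rrr (fst z) (snd z))" "continuous_on D (\<lambda>z. \<psi>rt (fst z) (snd z))"
    using cont by (simp_all add: case_prod_beta)
  have dt: "((\<lambda>t'. \<mu> * \<psi>r t' r / \<psi> t' r) has_real_derivative ut t r) (at t)"
    if z: "(t, r) \<in> D" for t r
    using DERIV_cmult[OF DERIV_ratio[OF deriv(5)[OF z] deriv(1)[OF z]], of \<mu>] dom[OF z]
    by (simp add: ut_def)
  have dr: "((\<lambda>r'. \<mu> * \<psi>r t r' / \<psi> t r') has_real_derivative ur t r) (at r)"
    if z: "(t, r) \<in> D" for t r
    using DERIV_cmult[OF DERIV_ratio[OF deriv(3)[OF z] deriv(2)[OF z]], of \<mu>] dom[OF z]
    by (simp add: ur_def power2_eq_square)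
  have drr: "((\<lambda>r'. ur t r') has_real_derivative urr t r) (at r)" if z: "(t, r) \<in> D" for t r
  proof -
    have nz: "\<psi> t r \<noteq> 0" using dom[OF z] by simp
    show ?thesis
      unfolding ur_def urr_def
      by (rule DERIV_cong[OF DERIV_cmult[OF DERIV_diff[OF
              DERIV_ratio[OF deriv(4)[OF z] deriv(2)[OF z] nz]
              DERIV_power[OF DERIV_ratio[OF deriv(3)[OF z] deriv(2)[OF z] nz]]]]])
        (simp add: ring_distribs power2_eq_square power3_eq_cube mult_ac)
  qed
  have pde: "ut t r = urr t r + (n - 1) * inverse r * ur t r
      + k * rpow (\<mu> * \<psi>r t r / \<psi> t r) (2 + 1)"
    if z: "(t, r) \<in> D" for t r
  proof -
    have nz: "\<psi> t r \<noteq> 0" using dom[OF z] by simp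
    obtain a b c where abc: "a = \<psi>r t r / \<psi> t r" "b = \<psi>rr t r / \<psi> t r" "c = \<psi>rrr t r / \<psi> t r"
      by blast
    have "k * (\<mu> * a) ^ 3 = (k * \<mu>\<^sup>2) * \<mu> * a ^ 3"
      by (simp add: power2_eq_square power3_eq_cube)
    also have "\<dots> = - 2 * \<mu> * a ^ 3"
      by (simp only: amplitude)
    finally have cubic: "k * rpow (\<mu> * \<psi>r t r / \<psi> t r) (2 + 1) = - 2 * \<mu> * a ^ 3"
      by (simp add: rpow_numeral abc)
    have lt: "\<psi>t t r / \<psi> t r = 3 * b + (n - 1) * inverse r * a + m t r"
      using nz unfolding linear(1)[OF z] abc by (simp add: add_divide_distrib)
    have lrt: "\<psi>rt t r / \<psi> t r = c + (n - 1) * inverse r * b + m t r * a"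
      using nz unfolding linear(2)[OF z] abc by (simp add: add_divide_distrib)
    show ?thesis
      unfolding cubic ut_def ur_def urr_def lt lrt abc[symmetric]
      by (simp add: ring_distribs power2_eq_square power3_eq_cube mult_ac)
  qed
  have nz: "\<forall>z\<in>D. \<psi> (fst z) (snd z) \<noteq> 0"
    using dom by (metis prod.collapse)
  have cd: "continuous_on D (\<lambda>z. \<mu> * \<psi>r (fst z) (snd z) / \<psi> (fst z) (snd z))"
      "continuous_on D (\<lambda>z. ut (fst z) (snd z))" "continuous_on D (\<lambda>z. ur (fst z) (snd z))"
      "continuous_on D (\<lambda>z. urr (fst z) (snd z))"
    unfolding ut_def ur_def urr_def by (intro continuous_intros c nz)+
  have pos: "0 < r \<and> rpow_defined (\<mu> * \<psi>r t r / \<psi> t r) (2 + 1)" if "(t, r) \<in> D" for t r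
    using dom[OF that] by (simp add: rpow_defined_def)
  show ?thesis
    by (rule radial_heat_solutionI[OF assms(1) pos cd dt dr drr pde])
qed

section \<open>Spatially constant solutions\<close>

lemma dom1_open: "open (dom1 k q c)"
proof -
  have "open ({x. rpow_defined x (- 1 / q) \<and> rpow_defined (rpow x (- 1 / q)) (q + 1)}
      \<inter> (if q \<in> \<int> then UNIV else {0<..}))" (is "open ?S")
    by (intro open_Int open_rpow_rpow_defined) auto
  then have "open {(t, r :: real). 0 < r \<and> - k * q * (t + c) \<in> ?S}"
    by (rule open_continuous_preimage_halfplane[where w = "\<lambda>t r. - k * q * (t + c)"])
      (intro continuous_intros)
  also have "{(t, r). 0 < r \<and> - k * q * (t + c) \<in> ?S} = dom1 k q c"
    by (auto simp: dom1_def u1_def)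
  finally show ?thesis .
qed

lemma DERIV_u1:
  assumes "q \<noteq> 0" and "(t, r) \<in> dom1 k q c"
  shows "((\<lambda>t'. u1 k q c t' r) has_real_derivative k * rpow (u1 k q c t r) (q + 1)) (at t)"
proof -
  have d: "rpow_defined (- k * q * (t + c)) (- 1 / q)" "0 < - k * q * (t + c) \<or> q \<in> \<int>"
    using assms(2) by (auto simp: dom1_def)
  have "((\<lambda>t'. - k * q * (t' + c)) has_real_derivative - k * q) (at t)"
    by (auto intro!: derivative_eq_intros)
  from DERIV_rpow_compose[OF this d(1)]
  have "((\<lambda>t'. u1 k q c t' r) has_real_derivative
      - 1 / q * rpow (- k * q * (t + c)) (- 1 / q - 1) * (- k * q)) (at t)"
    by (simp only: u1_def)
  also have "- 1 / q * rpow (- k * q * (t + c)) (- 1 / q - 1) * (- k * q)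
      = k * rpow (u1 k q c t r) (q + 1)"
    unfolding u1_def rpow_rpow_reciprocal[OF assms(1) d] using assms(1) by simp
  finally show ?thesis .
qed

lemma u1_solution:
  assumes "q \<noteq> 0"
  shows "radial_heat_solution n k q (dom1 k q c) (u1 k q c)"
proof -
  have c: "continuous_on (dom1 k q c) (\<lambda>z. u1 k q c (fst z) (snd z))"
    unfolding u1_def by (intro continuous_on_rpow continuous_intros) (auto simp: dom1_def)
  have pos: "0 < r \<and> rpow_defined (u1 k q c t r) (q + 1)" if "(t, r) \<in> dom1 k q c" for t r
    using that by (simp add: dom1_def)
  have cd: "continuous_on (dom1 k q c) (\<lambda>z. k * rpow (u1 k q c (fst z) (snd z)) (q + 1))"
      "continuous_on (dom1 k q c) (\<lambda>z. 0 :: real)"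
    by (intro continuous_intros continuous_on_rpow c) (auto simp: pos)
  have dr: "((\<lambda>r'. u1 k q c t r') has_real_derivative 0) (at r)"
    and drr: "((\<lambda>r'. 0 :: real) has_real_derivative 0) (at r)" for t r
    by (simp_all add: u1_def)
  show ?thesis
    by (rule radial_heat_solutionI[OF dom1_open pos c cd(1) cd(2) cd(2)
          DERIV_u1[OF assms] dr drr]) simp_all
qed

lemma u1_arises:
  assumes "q \<noteq> 0"
  shows "arises_from q (dom1 k q c) (u1 k q c) (G1 k q) H1"
proof -
  have "((\<lambda>t'. u1 k q c t' r) has_real_derivative
      r powr (- 2 / q - 2) * G1 k q (t / r\<^sup>2) (u1 k q c t r / r powr (- 2 / q))) (at t)"
    if z: "(t, r) \<in> dom1 k q c" for t r
  proof -
    from z have r: "0 < r" and d: "rpow_defined (u1 k q c t r) (q + 1)" by (auto simp: dom1_def)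
    have "- 2 / q * (q + 1) = - 2 / q - 2" using assms by (simp add: field_simps)
    then have "rpow (r powr (- 2 / q)) (q + 1) = r powr (- 2 / q - 2)"
      using r by (simp add: rpow_pos_base powr_powr)
    then have "r powr (- 2 / q - 2) * G1 k q (t / r\<^sup>2) (u1 k q c t r / r powr (- 2 / q))
        = k * rpow (u1 k q c t r) (q + 1)"
      using r by (simp add: G1_def rpow_divide_pos[OF d])
    then show ?thesis using DERIV_u1[OF assms z] by simp
  qed
  moreover have "((\<lambda>r'. u1 k q c t r') has_real_derivative
      r powr (- 2 / q - 1) * H1 (t / r\<^sup>2) (u1 k q c t r / r powr (- 2 / q))) (at r)" for t r
    by (simp add: u1_def H1_def)
  ultimately show ?thesis
    by (rule arises_fromI[OF refl])
qed

section \<open>Powers of a function linear in time\<close>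

context
  fixes n k q s c \<sigma> :: real and w :: "real \<Rightarrow> real \<Rightarrow> real"
  assumes n: "q = 2 / (2 - n)" "n \<noteq> 1" "n \<noteq> 2" "n \<noteq> 3" "n \<noteq> 4"
    and k: "k \<noteq> 0" "- k / ((n - 2) * (n - 3)) \<ge> 0" and s: "s \<in> {1, - 1}"
  defines "\<sigma> \<equiv> s * sqrt (- k / ((n - 2) * (n - 3)))"
    and "w \<equiv> \<lambda>t r. \<sigma> * (r / 2 - (n - 4) * (t + c) / r)"
begin

lemma exponents_nonzero: "n - 2 \<noteq> 0" "n - 3 \<noteq> 0" "2 - n \<noteq> 0"
  using n by simp_all

lemma exponent_times_q: "(n - 2) * q = - 2" "n - 2 = - 2 / q"
proof -
  show "(n - 2) * q = - 2" using exponents_nonzero(3) unfolding n(1) by (simp add: divide_simps)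
  then show "n - 2 = - 2 / q" using exponents_nonzero(3) unfolding n(1) by simp
qed

lemma k_eq_sigma: "k = - \<sigma>\<^sup>2 * (n - 2) * (n - 3)"
proof -
  have "\<sigma>\<^sup>2 = - k / ((n - 2) * (n - 3))"
    using k(2) s by (auto simp: \<sigma>_def power_mult_distrib)
  then have "\<sigma>\<^sup>2 * ((n - 2) * (n - 3)) = - k"
    using exponents_nonzero by simp
  then show ?thesis by (simp add: mult.assoc)
qed

lemma u2_as_power: "u2 n k s c = (\<lambda>t r. rpow (w t r) (n - 2))"
  by (simp add: u2_def w_def \<sigma>_def fun_eq_iff)

lemma dom2_as_preimage: "dom2 n k q s c =
    {(t, r). 0 < r \<and> w t r \<in> {x. rpow_defined x (n - 2) \<and> rpow_defined (rpow x (n - 2)) (q + 1)}}"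
  by (simp add: dom2_def u2_def w_def \<sigma>_def)

text \<open>
  The exclusion of \<open>n = 1, 3, 4\<close> is what rules out the exponents \<open>- 1, 1, 2\<close> here.
\<close>

lemma dom2_base_sign:
  assumes "(t, r) \<in> dom2 n k q s c"
  shows "0 < r" "0 < w t r \<or> w t r < 0 \<and> (\<exists>m. n - 2 = 2 * of_int m)"
proof -
  show "0 < r" using assms by (simp add: dom2_as_preimage)
  show "0 < w t r \<or> w t r < 0 \<and> (\<exists>m. n - 2 = 2 * of_int m)"
    using assms n(2-) by (intro rpow_twice_base_cases[OF exponent_times_q(1)]) (simp_all add: dom2_as_preimage)
qed

lemma base_continuous: "continuous_on {z. 0 < snd z} (\<lambda>z. w (fst z) (snd z))"
  unfolding w_def by (intro continuous_intros) auto

lemma base_derivatives: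
  assumes "0 < r"
  shows "((\<lambda>t'. w t' r) has_real_derivative - \<sigma> * (n - 4) / r) (at t)"
    "((\<lambda>r'. w t r') has_real_derivative \<sigma> * (1 / 2 + (n - 4) * (t + c) / r\<^sup>2)) (at r)"
    "((\<lambda>r'. \<sigma> * (1 / 2 + (n - 4) * (t + c) / r'\<^sup>2)) has_real_derivative
       - 2 * \<sigma> * (n - 4) * (t + c) / r ^ 3) (at r)"
  using assms unfolding w_def
  by (auto intro!: derivative_eq_intros simp: field_simps power2_eq_square power3_eq_cube)

lemma u2_solution: "radial_heat_solution n k q (dom2 n k q s c) (u2 n k s c)"
  unfolding u2_as_power
proof (rule power_solution[where D = "dom2 n k q s c" and w = w and a = "n - 2" and k = k
      and wt = "\<lambda>t r. - \<sigma> * (n - 4) / r"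
      and wr = "\<lambda>t r. \<sigma> * (1 / 2 + (n - 4) * (t + c) / r\<^sup>2)"
      and wrr = "\<lambda>t r. - 2 * \<sigma> * (n - 4) * (t + c) / r ^ 3"])
  show "open (dom2 n k q s c)"
    unfolding dom2_as_preimage by (intro open_continuous_preimage_halfplane open_rpow_rpow_defined base_continuous)
  have sub: "dom2 n k q s c \<subseteq> {z. 0 < snd z}" by (auto simp: dom2_def)
  then have pos: "\<forall>z \<in> dom2 n k q s c. snd z \<noteq> 0" by auto
  show "continuous_on (dom2 n k q s c) (\<lambda>(t, r). w t r)"
    using continuous_on_subset[OF base_continuous sub] by (simp add: case_prod_beta)
  show "continuous_on (dom2 n k q s c) (\<lambda>(t, r). - \<sigma> * (n - 4) / r)"
    "continuous_on (dom2 n k q s c) (\<lambda>(t, r). \<sigma> * (1 / 2 + (n - 4) * (t + c) / r\<^sup>2))"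
    "continuous_on (dom2 n k q s c) (\<lambda>(t, r). - 2 * \<sigma> * (n - 4) * (t + c) / r ^ 3)"
    unfolding case_prod_beta using pos by (intro continuous_intros; simp)+
next
  fix t r assume z: "(t, r) \<in> dom2 n k q s c"
  note r = dom2_base_sign(1)[OF z]
  show "0 < r \<and> w t r \<noteq> 0 \<and> rpow_defined (w t r) (n - 2) \<and>
      rpow_defined (rpow (w t r) (n - 2)) (q + 1)"
    using dom2_base_sign[OF z] z by (auto simp: dom2_as_preimage)
  show "rpow (rpow (w t r) (n - 2)) (q + 1) = rpow (w t r) (n - 2 - 2)"
    by (rule rpow_twice[OF exponent_times_q(1) dom2_base_sign(2)[OF z]])
  show "((\<lambda>t'. w t' r) has_real_derivative - \<sigma> * (n - 4) / r) (at t)"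
    "((\<lambda>r'. w t r') has_real_derivative \<sigma> * (1 / 2 + (n - 4) * (t + c) / r\<^sup>2)) (at r)"
    "((\<lambda>r'. \<sigma> * (1 / 2 + (n - 4) * (t + c) / r'\<^sup>2)) has_real_derivative
       - 2 * \<sigma> * (n - 4) * (t + c) / r ^ 3) (at r)"
    by (rule base_derivatives[OF r])+
  \<comment> \<open>In this variable \<open>w\<close> and its derivatives are polynomials times a power of \<open>r\<close>.\<close>
  define x where "x = (n - 4) * (t + c) / r\<^sup>2"
  have x: "w t r = \<sigma> * r * (1 / 2 - x)"
    "- 2 * \<sigma> * (n - 4) * (t + c) / r ^ 3 = - 2 * \<sigma> * x / r"
    using r by (simp_all add: w_def x_def field_simps power2_eq_square power3_eq_cube)
  show "(n - 2) * w t r * (- \<sigma> * (n - 4) / r) =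
      (n - 2) * (n - 2 - 1) * (\<sigma> * (1 / 2 + (n - 4) * (t + c) / r\<^sup>2))\<^sup>2 +
      (n - 2) * w t r * (- 2 * \<sigma> * (n - 4) * (t + c) / r ^ 3 +
        (n - 1) * inverse r * (\<sigma> * (1 / 2 + (n - 4) * (t + c) / r\<^sup>2))) + k"
    unfolding x x_def[symmetric] using r k_eq_sigma
    by (simp add: divide_simps) (simp add: algebra_simps power2_eq_square)
qed

text \<open>
  In the similarity variable \<open>v = u / r\<close> to the \<open>n - 2\<close> the power of \<open>v\<close> in \<open>G\<close> is
  \<open>w / r\<close> to the \<open>n - 3\<close>, so \<open>G\<close> is the \<open>t\<close>-derivative of \<open>u\<close> up to a power of \<open>r\<close> and a sign, and
  \<open>H\<close> amounts to the linear relation \<open>w\<^sub>r = \<sigma> - w / r\<close>.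
\<close>

lemma u2_arises_pos:
  assumes D: "D \<subseteq> {(t, r). 0 < r \<and> 0 < w t r}"
  shows "\<exists>s'\<in>{1, - 1}. arises_from q D (u2 n k s c) (G2 n k s') (H2 n k s')"
proof (rule bexI)
  \<comment> \<open>The factor \<open>n - 2\<close> of \<open>u\<^sub>t\<close> enters \<open>G\<close> through a square root, hence as an absolute value.\<close>
  let ?s = "s * sgn (n - 2)"
  show "?s \<in> {1, - 1}" using s n by (auto simp: sgn_if)
  have "- k * (n - 2) / (n - 3) = (n - 2)\<^sup>2 * (- k / ((n - 2) * (n - 3)))"
    using exponents_nonzero by (simp add: power2_eq_square)
  then have "sqrt (- k * (n - 2) / (n - 3)) = \<bar>n - 2\<bar> * sqrt (- k / ((n - 2) * (n - 3)))"
    by (simp only: real_sqrt_mult real_sqrt_abs)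
  then have "?s * (4 - n) * sqrt (- k * (n - 2) / (n - 3)) =
      \<sigma> * (4 - n) * (sgn (n - 2) * \<bar>n - 2\<bar>)"
    unfolding \<sigma>_def by (simp only: mult_ac)
  then have const: "?s * (4 - n) * sqrt (- k * (n - 2) / (n - 3)) = \<sigma> * (4 - n) * (n - 2)"
    by (simp only: sgn_mult_abs)
  have G: "G2 n k ?s (t / r\<^sup>2) (u2 n k s c t r / r powr (n - 2)) =
      \<sigma> * (4 - n) * (n - 2) * (w t r powr (n - 3) / r powr (n - 3))"
    and v: "u2 n k s c t r / r powr (n - 2) =
      w t r powr (n - 3) / r powr (n - 3) * (w t r / r)"
    if "(t, r) \<in> D" for t r
  proof -
    have pos: "0 < r" "0 < w t r" using D that by auto
    have v1: "u2 n k s c t r / r powr (n - 2) = (w t r / r) powr (n - 2)"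
      using pos by (simp add: u2_as_power rpow_pos_base powr_divide)
    have "(n - 2) * ((n - 3) / (n - 2)) = n - 3" using n by simp
    then have "rpow ((w t r / r) powr (n - 2)) ((n - 3) / (n - 2)) = (w t r / r) powr (n - 3)"
      using pos by (simp add: rpow_pos_base powr_powr)
    then show "G2 n k ?s (t / r\<^sup>2) (u2 n k s c t r / r powr (n - 2)) =
      \<sigma> * (4 - n) * (n - 2) * (w t r powr (n - 3) / r powr (n - 3))"
      unfolding G2_def v1 const powr_divide[symmetric] by simp
    have "(w t r / r) powr (n - 2) = (w t r / r) powr (n - 3 + 1)" by simp
    also have "\<dots> = w t r powr (n - 3) / r powr (n - 3) * (w t r / r)"
      using pos by (simp only: powr_add powr_divide) simp
    finally show "u2 n k s c t r / r powr (n - 2) =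
      w t r powr (n - 3) / r powr (n - 3) * (w t r / r)" unfolding v1 .
  qed
  have du: "((\<lambda>y. rpow (f y) (n - 2)) has_real_derivative (n - 2) * f x powr (n - 3) * f') (at x)"
    if "(f has_real_derivative f') (at x)" "0 < f x" for f f' x
    using DERIV_rpow_compose[OF that(1), of "n - 2"] that(2)
    by (simp add: rpow_defined_def rpow_pos_base)
  show "arises_from q D (u2 n k s c) (G2 n k ?s) (H2 n k ?s)"
  proof (rule arises_fromI[OF exponent_times_q(2)])
    fix t r assume z: "(t, r) \<in> D"
    then have pos: "0 < r" "0 < w t r" using D by auto
    have R: "r powr (n - 2 - 2) = r powr (n - 3) / r" "r powr (n - 2 - 1) = r powr (n - 3)"
      "r powr (n - 3) \<noteq> 0"
      using pos powr_diff[of r "n - 3" 1] by simp_all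
    show "((\<lambda>t'. u2 n k s c t' r) has_real_derivative
        r powr (n - 2 - 2) * G2 n k ?s (t / r\<^sup>2) (u2 n k s c t r / r powr (n - 2))) (at t)"
      unfolding G[OF z] R unfolding u2_as_power
      by (rule DERIV_cong[OF du[OF base_derivatives(1)[OF pos(1)] pos(2)]])
        (use R(3) pos in \<open>simp add: field_simps\<close>)
    show "((\<lambda>r'. u2 n k s c t r') has_real_derivative
        r powr (n - 2 - 1) * H2 n k ?s (t / r\<^sup>2) (u2 n k s c t r / r powr (n - 2))) (at r)"
      unfolding H2_def G[OF z] R unfolding v[OF z] unfolding u2_as_power
    proof (rule DERIV_cong[OF du[OF base_derivatives(2)[OF pos(1)] pos(2)]])
      define P Q W where "P = w t r powr (n - 3)" and "Q = r powr (n - 3)" and "W = w t r / r"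
      have wr: "\<sigma> * (1 / 2 + (n - 4) * (t + c) / r\<^sup>2) = \<sigma> - w t r / r"
        using pos(1) by (simp add: w_def field_simps power2_eq_square)
      have cancel: "1 / (4 - n) * (\<sigma> * (4 - n) * (n - 2) * (P / Q)) = \<sigma> * (n - 2) * (P / Q)"
        using n by simp
      have QP: "Q * (a * (P / Q) + b * (P / Q * W)) = P * (a + b * W)" for a b W
        using R(3) by (simp add: Q_def field_simps)
      show "(n - 2) * w t r powr (n - 3) * (\<sigma> * (1 / 2 + (n - 4) * (t + c) / r\<^sup>2)) =
        r powr (n - 3) * (1 / (4 - n) * (\<sigma> * (4 - n) * (n - 2) * (w t r powr (n - 3) / r powr (n - 3)))
          + (2 - n) * (w t r powr (n - 3) / r powr (n - 3) * (w t r / r)))"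
        unfolding wr P_def[symmetric] Q_def[symmetric] cancel QP W_def[symmetric]
        by (simp add: algebra_simps)
    qed
  qed
qed

end

text \<open>
  The base does not vanish on the domain, so it has one sign on a connected part of it. Where it
  is negative the exponent is even, and exchanging \<open>s\<close> for \<open>- s\<close> makes the base positive without
  changing \<open>u\<close>.
\<close>

lemma u2_arises:
  fixes n k q s c :: real
  assumes n: "q = 2 / (2 - n)" "n \<noteq> 1" "n \<noteq> 2" "n \<noteq> 3" "n \<noteq> 4"
    and k: "k \<noteq> 0" "- k / ((n - 2) * (n - 3)) \<ge> 0" and s: "s \<in> {1, - 1}"
    and D: "D \<subseteq> dom2 n k q s c" "connected D"
  shows "\<exists>s'\<in>{1, - 1}. arises_from q D (u2 n k s c) (G2 n k s') (H2 n k s')"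
proof -
  define w where "w s t r = s * sqrt (- k / ((n - 2) * (n - 3))) * (r / 2 - (n - 4) * (t + c) / r)"
    for s t r :: real
  note sign = dom2_base_sign[OF n k s, of _ _ c, folded w_def]
  have pos: "0 < r" if "(t, r) \<in> D" for t r using that D sign(1) by blast
  have nz: "w s t r \<noteq> 0" if "(t, r) \<in> D" for t r using that D sign(2) by fastforce
  have "continuous_on D (\<lambda>z. w s (fst z) (snd z))"
    unfolding w_def using pos by (intro continuous_intros; force)
  then have "connected ((\<lambda>z. w s (fst z) (snd z)) ` D)"
    using D(2) by (rule connected_continuous_image)
  then have I: "is_interval ((\<lambda>z. w s (fst z) (snd z)) ` D)"
    by (simp add: is_interval_connected_1)
  have "0 \<notin> (\<lambda>z. w s (fst z) (snd z)) ` D"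
    using nz by auto
  then have "(\<forall>z\<in>D. 0 < w s (fst z) (snd z)) \<or> (\<forall>z\<in>D. w s (fst z) (snd z) < 0)"
    using I unfolding is_interval_1 by (smt (verit) image_iff)
  then show ?thesis
  proof
    assume "\<forall>z\<in>D. 0 < w s (fst z) (snd z)"
    then have "D \<subseteq> {(t, r). 0 < r \<and> 0 < w s t r}" using pos by auto
    then show ?thesis by (rule u2_arises_pos[OF n k s, of D c, folded w_def])
  next
    assume neg: "\<forall>z\<in>D. w s (fst z) (snd z) < 0"
    show ?thesis
    proof (cases "D = {}")
      case True
      then show ?thesis by (intro bexI[of _ 1]) (simp_all add: arises_from_def)
    next
      case False
      then obtain m where m: "n - 2 = 2 * of_int m"
        using neg sign(2) D(1) by fastforce
      have minus: "w (- s) t r = - w s t r" for t r by (simp add: w_def)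
      have "u2 n k (- s) c = u2 n k s c"
        unfolding u2_def w_def[symmetric] minus rpow_minus_even[OF m] ..
      moreover have "D \<subseteq> {(t, r). 0 < r \<and> 0 < w (- s) t r}"
        using neg pos by (auto simp: minus)
      moreover have "- s \<in> {1, - 1}" using s by auto
      ultimately show ?thesis
        using u2_arises_pos[OF n k, of "- s" D c, folded w_def] by simp
    qed
  qed
qed

section \<open>Square roots in dimension 5/2\<close>

text \<open>
  The base of the square root is \<open>\<sigma> (y + c y\<^sup>2) / r\<close> with \<open>y = 3 t + r\<^sup>2\<close>, where \<open>\<sigma>\<^sup>2 = k\<close>. The
  constant \<open>c\<close> disappears from the first-order equations because \<open>u\<^sup>2 r = \<sigma> (y + c y\<^sup>2)\<close> expresses
  it through \<open>u\<close>.
\<close>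

lemma u3_solution_arises:
  fixes k s c :: real
  assumes k: "0 < k" and s: "s \<in> {1, - 1}"
  shows "radial_heat_solution (5 / 2) k (- 4) (dom3 k (- 4) s c) (u3 k s c)"
    and "arises_from (- 4) (dom3 k (- 4) s c) (u3 k s c) (G3 k (- s)) (H3 k (- s))"
proof -
  define \<sigma> where "\<sigma> = s * sqrt k"
  have \<sigma>: "k = \<sigma>\<^sup>2" using k s by (auto simp: \<sigma>_def power_mult_distrib)
  define w where "w t r = \<sigma> * (1 + c * (3 * t + r\<^sup>2)) * (3 * t / r + r)" for t r
  define wt where "wt t r = \<sigma> * (3 + 6 * c * (3 * t + r\<^sup>2)) / r" for t r
  define wr where "wr t r = \<sigma> * (2 + 4 * c * (3 * t + r\<^sup>2)
    - (3 * t + r\<^sup>2) * (1 + c * (3 * t + r\<^sup>2)) / r\<^sup>2)" for t r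
  define wrr where "wrr t r = \<sigma> * (8 * c * r - 2 * (1 + 2 * c * (3 * t + r\<^sup>2)) / r
    + 2 * (3 * t + r\<^sup>2) * (1 + c * (3 * t + r\<^sup>2)) / r ^ 3)" for t r
  define D where "D = dom3 k (- 4) s c"
  have not_int: "(1 / 2 :: real) \<notin> \<int>"
  proof
    assume "(1 / 2 :: real) \<in> \<int>"
    then obtain m :: int where "1 / 2 = real_of_int m" by (auto elim: Ints_cases)
    then have "real_of_int (2 * m) = 1" by simp
    then have "2 * m = 1" by linarith
    then show False by presburger
  qed
  have D_eq: "D = {(t, r). 0 < r \<and> w t r \<in> {0<..}}"
    unfolding D_def dom3_def u3_def \<sigma>_def[symmetric] w_def[symmetric]
    using not_int by (auto simp: rpow_defined_def rpow_pos_base)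
  then have pos: "0 < r" "0 < w t r" if "(t, r) \<in> D" for t r
    using that by auto
  have u: "u3 k s c = (\<lambda>t r. rpow (w t r) (1 / 2))"
    by (simp add: u3_def w_def \<sigma>_def fun_eq_iff)
  have "continuous_on {z. 0 < snd z} (\<lambda>z. w (fst z) (snd z))"
    unfolding w_def by (intro continuous_intros) auto
  then have D: "open D"
    unfolding D_eq by (intro open_continuous_preimage_halfplane) auto
  have dwt: "((\<lambda>t'. w t' r) has_real_derivative wt t r) (at t)" if "0 < r" for t r
    unfolding w_def using that
    by (auto intro!: derivative_eq_intros simp: wt_def field_simps power2_eq_square)
  have dwr: "((\<lambda>r'. w t r') has_real_derivative wr t r) (at r)" if "0 < r" for t r
    unfolding w_def using that
    by (auto intro!: derivative_eq_intros) (simp add: wr_def field_simps power2_eq_square)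
  have dwrr: "((\<lambda>r'. wr t r') has_real_derivative wrr t r) (at r)" if "0 < r" for t r
    unfolding wr_def using that
    by (auto intro!: derivative_eq_intros simp: wrr_def field_simps power2_eq_square power3_eq_cube)
  have nz: "\<forall>z\<in>D. snd z \<noteq> 0" using pos(1) by force
  have cont: "continuous_on D (\<lambda>(t, r). w t r)" "continuous_on D (\<lambda>(t, r). wt t r)"
    "continuous_on D (\<lambda>(t, r). wr t r)" "continuous_on D (\<lambda>(t, r). wrr t r)"
    unfolding w_def wt_def wr_def wrr_def case_prod_beta
    by (intro continuous_intros; use nz in simp)+
  have dom: "0 < r \<and> w t r \<noteq> 0 \<and> rpow_defined (w t r) (1 / 2) \<and>
       rpow_defined (rpow (w t r) (1 / 2)) (- 4 + 1)" if "(t, r) \<in> D" for t r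
    using pos[OF that] by (simp add: rpow_defined_def rpow_pos_base)
  have pow: "rpow (rpow (w t r) (1 / 2)) (- 4 + 1) = rpow (w t r) (1 / 2 - 2)"
    if "(t, r) \<in> D" for t r
    by (rule rpow_twice) (simp_all add: pos[OF that])
  have eq: "1 / 2 * w t r * wt t r = 1 / 2 * (1 / 2 - 1) * (wr t r)\<^sup>2
       + 1 / 2 * w t r * (wrr t r + (5 / 2 - 1) * inverse r * wr t r) + k"
    if z: "(t, r) \<in> D" for t r
  proof -
    \<comment> \<open>Eliminating \<open>t\<close> in favour of \<open>y\<close> turns both factors that contain \<open>t\<close> into monomials.\<close>
    define y where "y = (3 * t + r\<^sup>2) / r\<^sup>2"
    have y: "3 * t + r\<^sup>2 = y * r\<^sup>2" "3 * t / r + r = y * r"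
      using pos(1)[OF z] by (simp_all add: y_def field_simps power2_eq_square)
    show ?thesis
      unfolding w_def wt_def wr_def wrr_def \<sigma> y using pos(1)[OF z]
      by (simp add: divide_simps)
        (simp add: algebra_simps power2_eq_square power3_eq_cube)
  qed
  show "radial_heat_solution (5 / 2) k (- 4) (dom3 k (- 4) s c) (u3 k s c)"
    unfolding u D_def[symmetric]
    by (rule power_solution[OF D cont dom dwt dwr dwrr pow eq]) (auto dest: pos)
  show "arises_from (- 4) (dom3 k (- 4) s c) (u3 k s c) (G3 k (- s)) (H3 k (- s))"
    unfolding D_def[symmetric]
  proof (rule arises_fromI)
    show "1 / 2 = - 2 / (- 4 :: real)" by simp
    fix t r assume z: "(t, r) \<in> D"
    define U where "U = u3 k s c t r"
    have U: "0 < U" "w t r = U\<^sup>2"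
      using pos[OF z] by (simp_all add: U_def u rpow_pos_base powr_half_sqrt)
    have du: "((\<lambda>y. rpow (f y) (1 / 2)) has_real_derivative f' / (2 * U)) (at x)"
      if "(f has_real_derivative f') (at x)" "f x = w t r" for f f' x
      using DERIV_rpow_compose[OF that(1), of "1 / 2"] that(2) pos[OF z]
      by (simp add: rpow_defined_def rpow_pos_base U_def u powr_half_sqrt powr_minus_divide)
    define y where "y = 3 * t + r\<^sup>2"
    define \<rho> where "\<rho> = sqrt r"
    have \<rho>: "0 < \<rho>" "r = \<rho>\<^sup>2" "r powr (1 / 2) = \<rho>"
      using pos[OF z] by (simp_all add: \<rho>_def powr_half_sqrt)
    have R: "r powr (1 / 2 - 2) = \<rho> / r\<^sup>2" "r powr (1 / 2 - 1) = \<rho> / r"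
      using pos[OF z] powr_diff[of r "1 / 2" 2] powr_diff[of r "1 / 2" 1] by (simp_all add: \<rho>(3))
    have Uy: "U\<^sup>2 * r = \<sigma> * (1 + c * y) * y"
      using pos[OF z] unfolding U(2)[symmetric] w_def y_def by (simp add: field_simps power2_eq_square)
    then have y: "y \<noteq> 0" using U pos[OF z] by auto
    have x: "3 * (t / r\<^sup>2) + 1 = y / r\<^sup>2"
      using pos[OF z] by (simp add: y_def field_simps)
    have s\<sigma>: "- s * (3 * sqrt k / (2 * v)) = - (3 * \<sigma> / (2 * v))" for v
      by (simp add: \<sigma>_def)
    have sq: "\<sigma> = U\<^sup>2 * r / y - \<sigma> * c * y"
      using Uy y by (simp add: field_simps)
    have G: "r powr (1 / 2 - 2) * G3 k (- s) (t / r\<^sup>2) (U / r powr (1 / 2))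
        = wt t r / (2 * U)"
    proof -
      have "r powr (1 / 2 - 2) * G3 k (- s) (t / r\<^sup>2) (U / r powr (1 / 2))
          = 3 * U / y - 3 * \<sigma> / (2 * U * r)"
        unfolding G3_def R x s\<sigma> \<rho>(3) using \<rho>(1) U(1) y unfolding \<rho>(2)
        by (simp add: field_simps power2_eq_square)
      also have "\<dots> = (6 * (U\<^sup>2 * r) - 3 * \<sigma> * y) / (2 * U * r * y)"
        using pos[OF z] U(1) y by (simp add: field_simps power2_eq_square)
      also have "\<dots> = wt t r / (2 * U)"
        unfolding Uy wt_def y_def[symmetric]
        using pos[OF z] U(1) y by (simp add: field_simps)
      finally show ?thesis .
    qed
    show "((\<lambda>t'. u3 k s c t' r) has_real_derivative
        r powr (1 / 2 - 2) * G3 k (- s) (t / r\<^sup>2) (u3 k s c t r / r powr (1 / 2))) (at t)"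
      unfolding U_def[symmetric] G unfolding u
      by (rule du[OF dwt[OF pos(1)[OF z]] refl])
    have "r powr (1 / 2 - 1) * H3 k (- s) (t / r\<^sup>2) (U / r powr (1 / 2))
        = 2 / 3 * r * (r powr (1 / 2 - 2) * G3 k (- s) (t / r\<^sup>2) (U / r powr (1 / 2))) - U / (2 * r)"
      unfolding H3_def R \<rho>(3) using pos[OF z] \<rho>(1) by (simp add: field_simps power2_eq_square)
    also have "\<dots> = (2 * r * wt t r / 3 - U\<^sup>2 / r) / (2 * U)"
      unfolding G using pos[OF z] U(1) by (simp add: field_simps power2_eq_square)
    also have "2 * r * wt t r / 3 - U\<^sup>2 / r = wr t r"
      unfolding U(2)[symmetric] w_def wt_def wr_def using pos[OF z]
      by (simp add: field_simps power2_eq_square)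
    finally have H: "r powr (1 / 2 - 1) * H3 k (- s) (t / r\<^sup>2) (U / r powr (1 / 2))
        = wr t r / (2 * U)" .
    show "((\<lambda>r'. u3 k s c t r') has_real_derivative
        r powr (1 / 2 - 1) * H3 k (- s) (t / r\<^sup>2) (u3 k s c t r / r powr (1 / 2))) (at r)"
      unfolding U_def[symmetric] H unfolding u
      by (rule du[OF dwr[OF pos(1)[OF z]] refl])
  qed
qed

section \<open>Cubic nonlinearity in dimension 5/2\<close>

text \<open>
  The logarithmic derivatives below are taken of functions of the form \<open>sqrt r\<close> times a rational
  function, up to an additive constant. Differentiation preserves this form, and the factor \<open>sqrt r\<close> cancels in the end.
\<close>

lemma DERIV_sqrt_mult:
  assumes "0 < r" and "(f has_real_derivative f') (at r)"
  shows "((\<lambda>x. sqrt x * f x) has_real_derivative sqrt r * (f' + f r / (2 * r))) (at r)"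
proof (rule DERIV_cong[OF DERIV_mult[OF DERIV_real_sqrt[OF assms(1)] assms(2)]])
  have "inverse (sqrt r) = sqrt r / r"
    using assms(1) by (simp add: field_simps)
  then show "inverse (sqrt r) / 2 * f r + f' * sqrt r = sqrt r * (f' + f r / (2 * r))"
    using assms(1) by (simp add: field_simps)
qed

text \<open>
  The radical enters all formulas only through \<open>\<sigma>\<close>, because \<open>s\<close> is its own inverse.
\<close>

context
  fixes k s \<sigma> :: real
  assumes k: "k < 0" and s: "s \<in> {1, - 1}"
  defines "\<sigma> \<equiv> s / sqrt (- 2 * k)"
begin

lemma amplitude: "k * (2 * \<sigma>)\<^sup>2 = - 2" "k * (- 2 * \<sigma>)\<^sup>2 = - 2" "\<sigma> \<noteq> 0"
proof -
  have "\<sigma>\<^sup>2 = 1 / (- 2 * k)"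
    using k s by (auto simp: \<sigma>_def power_divide)
  then show "k * (2 * \<sigma>)\<^sup>2 = - 2" "k * (- 2 * \<sigma>)\<^sup>2 = - 2"
    using k by (simp_all add: power_mult_distrib)
  then show "\<sigma> \<noteq> 0" by auto
qed

lemma sqrt_sigma: "s * sqrt (- 2 * k) = 1 / \<sigma>" "s / sqrt (- 2 * k) = \<sigma>"
  using s k by (auto simp: \<sigma>_def)

text \<open>
  The sign in front of \<open>s\<close> is the one for which the pair belongs to the solution with sign \<open>s\<close>.
\<close>

lemma GH_normal_form:
  "G4 k (- s) x v = 3 * v * (1 - v / \<sigma>) / (3 * x + 1)"
  "H4 k (- s) x v = 1 / 6 * (3 * x + 1) * G4 k (- s) x v - (3 * x - 1) / (3 * x + 1) * v"
  "G5 k s x v = 3 / 4 * (v - \<sigma>)\<^sup>2 / \<sigma>"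
  "H5 k s x v = 2 / 3 * G5 k s x v + v - 2 * \<sigma>"
  "G6 k (- s) x v = - 15 / 4 * (v - \<sigma>)\<^sup>2 / \<sigma>"
  "H6 k (- s) x v = 2 / 15 * G6 k (- s) x v + v - 2 * \<sigma>"
proof -
  define A where "A = sqrt (- 2 * k)"
  have sA: "s * A = 1 / \<sigma>" and sa: "s / A = \<sigma>"
    unfolding A_def by (rule sqrt_sigma)+
  have e1: "a * \<sigma> = s * (a / A)" "a * (s * A) = a / \<sigma>" for a
    by (simp_all add: sA flip: sa)
  have e: "- s * A = - (1 / \<sigma>)" "- s * (a / A) = - (a * \<sigma>)" "s * (a / A) = a * \<sigma>"
    for a
    by (simp_all add: sA e1(1))
  have e': "s * a * A = a / \<sigma>" "- s * a * A = - a / \<sigma>" for a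
    using e1(2)[of a] by (simp_all add: mult_ac)
  show "G4 k (- s) x v = 3 * v * (1 - v / \<sigma>) / (3 * x + 1)"
    unfolding G4_def A_def[symmetric] e e' by simp
  show "H4 k (- s) x v = 1 / 6 * (3 * x + 1) * G4 k (- s) x v - (3 * x - 1) / (3 * x + 1) * v"
    by (rule H4_def)
  show "G5 k s x v = 3 / 4 * (v - \<sigma>)\<^sup>2 / \<sigma>"
    unfolding G5_def A_def[symmetric] e e' by simp
  show "H5 k s x v = 2 / 3 * G5 k s x v + v - 2 * \<sigma>"
    unfolding H5_def A_def[symmetric] e e' by simp
  show "G6 k (- s) x v = - 15 / 4 * (v - \<sigma>)\<^sup>2 / \<sigma>"
    unfolding G6_def A_def[symmetric] e e' by simp
  show "H6 k (- s) x v = 2 / 15 * G6 k (- s) x v + v - 2 * \<sigma>"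
    unfolding H6_def A_def[symmetric] e e' by simp
qed

lemma u_normal_form:
  "u4 k s c = (\<lambda>t r. \<sigma> * (5 * (3 * t + r\<^sup>2)) / (r * (15 * t + r\<^sup>2) + c * sqrt r))"
  "u5 k s c = (\<lambda>t r. \<sigma> * (3 * (t + c - r\<^sup>2)) / (r * (3 * (t + c) + r\<^sup>2)))"
  "u6 k s c = (\<lambda>t r. \<sigma> * (5 * (3 * (t + c) + r\<^sup>2)) / (r * (15 * (t + c) + r\<^sup>2)))"
  by (simp_all add: u4_def u5_def u6_def \<sigma>_def fun_eq_iff)

text \<open>
  The two shifts serve different solutions: \<open>u4\<close> has \<open>b = 0\<close>, and \<open>u6\<close> has \<open>c = 0\<close>. Near a zero of
  the denominator \<open>u\<close> behaves like \<open>2 \<sigma>\<close> times the logarithmic derivative of the denominator, and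
  dividing the denominator by \<open>sqrt r\<close> makes this exact and gives \<open>\<psi>\<close>. Both linear equations hold with
  multiplier \<open>0\<close>.
\<close>

lemma cubic_solution_plus:
  assumes "open D"
    and dom: "\<And>t r. (t, r) \<in> D \<Longrightarrow> 0 < r \<and> r * (15 * (t + b) + r\<^sup>2) + c * sqrt r \<noteq> 0"
  shows "radial_heat_solution (5 / 2) k 2 D
    (\<lambda>t r. \<sigma> * (5 * (3 * (t + b) + r\<^sup>2)) / (r * (15 * (t + b) + r\<^sup>2) + c * sqrt r))"
proof -
  define \<psi> where "\<psi> t r = sqrt r * (15 * (t + b) + r\<^sup>2) + c" for t r
  define \<psi>t where "\<psi>t t r = 15 * sqrt r" for t r :: real
  define \<psi>r where "\<psi>r t r = sqrt r * ((15 * (t + b) + 5 * r\<^sup>2) / (2 * r))" for t r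
  define \<psi>rr where "\<psi>rr t r = sqrt r * (15 * (r\<^sup>2 - (t + b)) / (4 * r\<^sup>2))" for t r
  define \<psi>rrr where "\<psi>rrr t r = sqrt r * (15 * (3 * (t + b) + r\<^sup>2) / (8 * r ^ 3))" for t r
  define \<psi>rt where "\<psi>rt t r = sqrt r * (15 / (2 * r))" for t r :: real
  have pos: "0 < r" if "(t, r) \<in> D" for t r using dom[OF that] by simp
  have M: "r * (15 * (t + b) + r\<^sup>2) + c * sqrt r = sqrt r * \<psi> t r" if "0 < r" for t r
    using that by (simp add: \<psi>_def distrib_left mult.commute[of c] flip: mult.assoc)
  have dom': "0 < r \<and> \<psi> t r \<noteq> 0" if "(t, r) \<in> D" for t r
    using dom[OF that] M[of r t] by auto
  have nz: "\<forall>z\<in>D. snd z \<noteq> 0" using pos by force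
  have cont: "continuous_on D (\<lambda>(t, r). \<psi> t r)" "continuous_on D (\<lambda>(t, r). \<psi>t t r)"
      "continuous_on D (\<lambda>(t, r). \<psi>r t r)" "continuous_on D (\<lambda>(t, r). \<psi>rr t r)"
      "continuous_on D (\<lambda>(t, r). \<psi>rrr t r)" "continuous_on D (\<lambda>(t, r). \<psi>rt t r)"
    unfolding \<psi>_def \<psi>t_def \<psi>r_def \<psi>rr_def \<psi>rrr_def \<psi>rt_def case_prod_beta
    by (intro continuous_intros; use nz in simp)+
  have d: "((\<lambda>t'. \<psi> t' r) has_real_derivative \<psi>t t r) (at t)"
      "((\<lambda>t'. \<psi>r t' r) has_real_derivative \<psi>rt t r) (at t)" if "0 < r" for t r
    unfolding \<psi>_def \<psi>t_def \<psi>r_def \<psi>rt_def using that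
    by (auto intro!: derivative_eq_intros)
  have rat1: "((\<lambda>x. 15 * (t + b) + x\<^sup>2) has_real_derivative 2 * r) (at r)" for t r
    by (auto intro!: derivative_eq_intros)
  have rat2: "((\<lambda>x. (15 * (t + b) + 5 * x\<^sup>2) / (2 * x)) has_real_derivative
      5 / 2 - 15 * (t + b) / (2 * r\<^sup>2)) (at r)" if "0 < r" for t r
    using that by (auto intro!: derivative_eq_intros)
      (simp add: field_simps power2_eq_square)
  have rat3: "((\<lambda>x. 15 * (x\<^sup>2 - (t + b)) / (4 * x\<^sup>2)) has_real_derivative
      15 * (t + b) / (2 * r ^ 3)) (at r)" if "0 < r" for t r
    using that by (auto intro!: derivative_eq_intros)
      (simp add: field_simps eval_nat_numeral)
  have d\<psi>: "((\<lambda>r'. \<psi> t r') has_real_derivative \<psi>r t r) (at r)" if "0 < r" for t r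
    unfolding \<psi>_def
    by (rule DERIV_cong[OF DERIV_add[OF DERIV_sqrt_mult[OF that rat1] DERIV_const]])
      (use that in \<open>simp add: \<psi>r_def field_simps power2_eq_square\<close>)
  have d\<psi>r: "((\<lambda>r'. \<psi>r t r') has_real_derivative \<psi>rr t r) (at r)" if "0 < r" for t r
    unfolding \<psi>r_def
    by (rule DERIV_cong[OF DERIV_sqrt_mult[OF that rat2[OF that]]])
      (use that in \<open>simp add: \<psi>rr_def field_simps power2_eq_square\<close>)
  have d\<psi>rr: "((\<lambda>r'. \<psi>rr t r') has_real_derivative \<psi>rrr t r) (at r)" if "0 < r" for t r
    unfolding \<psi>rr_def
    by (rule DERIV_cong[OF DERIV_sqrt_mult[OF that rat3[OF that]]])
      (use that in \<open>simp add: \<psi>rrr_def field_simps eval_nat_numeral\<close>)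
  have lin: "\<psi>t t r = 3 * \<psi>rr t r + (5 / 2 - 1) * inverse r * \<psi>r t r + 0 * \<psi> t r"
    "\<psi>rt t r = \<psi>rrr t r + (5 / 2 - 1) * inverse r * \<psi>rr t r + 0 * \<psi>r t r"
    if "0 < r" for t r
    using that unfolding \<psi>t_def \<psi>r_def \<psi>rr_def \<psi>rrr_def \<psi>rt_def
    by (simp_all add: field_simps eval_nat_numeral)
  have "radial_heat_solution (5 / 2) k 2 D (\<lambda>t r. 2 * \<sigma> * \<psi>r t r / \<psi> t r)"
    by (rule log_derivative_solution[where m = "\<lambda>_ _. 0", OF assms(1) amplitude(1) cont dom'
          d(1) d\<psi> d\<psi>r d\<psi>rr d(2) lin]) (auto dest: pos)
  then show ?thesis
  proof (rule radial_heat_solution_cong)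
    fix t r assume z: "(t, r) \<in> D"
    have "\<psi>r t r = sqrt r * (5 * (3 * (t + b) + r\<^sup>2)) / (2 * r)"
      by (simp add: \<psi>r_def algebra_simps)
    also have "\<dots> = 5 * (3 * (t + b) + r\<^sup>2) / (2 * sqrt r)"
      using pos[OF z] by (simp add: divide_simps)
    finally show "\<sigma> * (5 * (3 * (t + b) + r\<^sup>2)) / (r * (15 * (t + b) + r\<^sup>2) + c * sqrt r)
        = 2 * \<sigma> * \<psi>r t r / \<psi> t r"
      unfolding M[OF pos[OF z]] by simp
  qed
qed

text \<open>
  Here the residue at a zero of the denominator is \<open>- 2 \<sigma>\<close>, the other root of \<open>k \<mu>\<^sup>2 = - 2\<close>. The
  linear equations hold with the multiplier \<open>- 3 / (2 r\<^sup>2)\<close>.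
\<close>

lemma cubic_solution_minus:
  assumes "open D"
    and dom: "\<And>t r. (t, r) \<in> D \<Longrightarrow> 0 < r \<and> 3 * (t + c) + r\<^sup>2 \<noteq> 0"
  shows "radial_heat_solution (5 / 2) k 2 D
    (\<lambda>t r. \<sigma> * (3 * (t + c - r\<^sup>2)) / (r * (3 * (t + c) + r\<^sup>2)))"
proof -
  define \<psi> where "\<psi> t r = sqrt r * ((3 * (t + c) + r\<^sup>2) / r)" for t r
  define \<psi>t where "\<psi>t t r = sqrt r * (3 / r)" for t r :: real
  define \<psi>r where "\<psi>r t r = sqrt r * (3 * (r\<^sup>2 - (t + c)) / (2 * r\<^sup>2))" for t r
  define \<psi>rr where "\<psi>rr t r = sqrt r * (3 * (3 * (t + c) + r\<^sup>2) / (4 * r ^ 3))" for t r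
  define \<psi>rrr where "\<psi>rrr t r = sqrt r * (- 3 * (15 * (t + c) + r\<^sup>2) / (8 * r ^ 4))" for t r
  define \<psi>rt where "\<psi>rt t r = sqrt r * (- 3 / (2 * r\<^sup>2))" for t r :: real
  have pos: "0 < r" if "(t, r) \<in> D" for t r using dom[OF that] by simp
  have dom': "0 < r \<and> \<psi> t r \<noteq> 0" if "(t, r) \<in> D" for t r
    using dom[OF that] by (simp add: \<psi>_def)
  have nz: "\<forall>z\<in>D. snd z \<noteq> 0" using pos by force
  have cont: "continuous_on D (\<lambda>(t, r). \<psi> t r)" "continuous_on D (\<lambda>(t, r). \<psi>t t r)"
      "continuous_on D (\<lambda>(t, r). \<psi>r t r)" "continuous_on D (\<lambda>(t, r). \<psi>rr t r)"
      "continuous_on D (\<lambda>(t, r). \<psi>rrr t r)" "continuous_on D (\<lambda>(t, r). \<psi>rt t r)"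
    unfolding \<psi>_def \<psi>t_def \<psi>r_def \<psi>rr_def \<psi>rrr_def \<psi>rt_def case_prod_beta
    by (intro continuous_intros; use nz in simp)+
  have d: "((\<lambda>t'. \<psi> t' r) has_real_derivative \<psi>t t r) (at t)"
      "((\<lambda>t'. \<psi>r t' r) has_real_derivative \<psi>rt t r) (at t)" if "0 < r" for t r
    unfolding \<psi>_def \<psi>t_def \<psi>r_def \<psi>rt_def using that
    by (auto intro!: derivative_eq_intros) (simp add: field_simps power2_eq_square power4_eq_xxxx)
  have rat: "((\<lambda>x. (3 * (t + c) + x\<^sup>2) / x) has_real_derivative 1 - 3 * (t + c) / r\<^sup>2) (at r)"
      "((\<lambda>x. 3 * (x\<^sup>2 - (t + c)) / (2 * x\<^sup>2)) has_real_derivative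
          3 * (t + c) / r ^ 3) (at r)"
      "((\<lambda>x. 3 * (3 * (t + c) + x\<^sup>2) / (4 * x ^ 3)) has_real_derivative
          - 3 * (9 * (t + c) + r\<^sup>2) / (4 * r ^ 4)) (at r)" if "0 < r" for t r
    using that by (auto intro!: derivative_eq_intros)
      (use that in \<open>simp_all add: field_simps eval_nat_numeral\<close>)
  have d\<psi>: "((\<lambda>r'. \<psi> t r') has_real_derivative \<psi>r t r) (at r)" if "0 < r" for t r
    unfolding \<psi>_def
    by (rule DERIV_cong[OF DERIV_sqrt_mult[OF that rat(1)[OF that]]])
      (use that in \<open>simp add: \<psi>r_def field_simps power2_eq_square\<close>)
  have d\<psi>r: "((\<lambda>r'. \<psi>r t r') has_real_derivative \<psi>rr t r) (at r)" if "0 < r" for t r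
    unfolding \<psi>r_def
    by (rule DERIV_cong[OF DERIV_sqrt_mult[OF that rat(2)[OF that]]])
      (use that in \<open>simp add: \<psi>rr_def field_simps power2_eq_square power3_eq_cube\<close>)
  have d\<psi>rr: "((\<lambda>r'. \<psi>rr t r') has_real_derivative \<psi>rrr t r) (at r)" if "0 < r" for t r
    unfolding \<psi>rr_def
    by (rule DERIV_cong[OF DERIV_sqrt_mult[OF that rat(3)[OF that]]])
      (use that in \<open>simp add: \<psi>rrr_def field_simps eval_nat_numeral\<close>)
  have lin: "\<psi>t t r = 3 * \<psi>rr t r + (5 / 2 - 1) * inverse r * \<psi>r t r + - 3 / (2 * r\<^sup>2) * \<psi> t r"
    "\<psi>rt t r = \<psi>rrr t r + (5 / 2 - 1) * inverse r * \<psi>rr t r + - 3 / (2 * r\<^sup>2) * \<psi>r t r"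
    if "0 < r" for t r
    using that unfolding \<psi>_def \<psi>t_def \<psi>r_def \<psi>rr_def \<psi>rrr_def \<psi>rt_def
    by (simp_all add: field_simps power2_eq_square power3_eq_cube power4_eq_xxxx)
  have "radial_heat_solution (5 / 2) k 2 D (\<lambda>t r. - 2 * \<sigma> * \<psi>r t r / \<psi> t r)"
    by (rule log_derivative_solution[where m = "\<lambda>t r. - 3 / (2 * r\<^sup>2)", OF assms(1) amplitude(2)
          cont dom' d(1) d\<psi> d\<psi>r d\<psi>rr d(2) lin]) (auto dest: pos)
  then show ?thesis
  proof (rule radial_heat_solution_cong)
    fix t r assume z: "(t, r) \<in> D"
    show "\<sigma> * (3 * (t + c - r\<^sup>2)) / (r * (3 * (t + c) + r\<^sup>2)) = - 2 * \<sigma> * \<psi>r t r / \<psi> t r"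
      using dom[OF z] unfolding \<psi>_def \<psi>r_def
      by (simp add: divide_simps) (simp add: algebra_simps power2_eq_square)
  qed
qed

lemma u4_solution: "radial_heat_solution (5 / 2) k 2 (dom4 c) (u4 k s c)"
proof -
  have "continuous_on {z. 0 < snd z} (\<lambda>z. (\<lambda>t r. r * (15 * t + r\<^sup>2) + c * sqrt r) (fst z) (snd z))"
    by (intro continuous_intros)
  from open_continuous_preimage_halfplane[OF _ this, of "- {0}"]
  have "open (dom4 c)" by (simp add: dom4_def open_Compl)
  from cubic_solution_plus[of "dom4 c" 0 c, OF this] show ?thesis
    unfolding u_normal_form add_0_right mult_zero_left by (simp add: dom4_def)
qed

lemma u5_solution: "radial_heat_solution (5 / 2) k 2 (dom5 c) (u5 k s c)"
proof -
  have "continuous_on {z. 0 < snd z} (\<lambda>z. (\<lambda>t r. 3 * (t + c) + r\<^sup>2) (fst z) (snd z))"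
    by (intro continuous_intros)
  from open_continuous_preimage_halfplane[OF _ this, of "- {0}"]
  have "open (dom5 c)" by (simp add: dom5_def open_Compl)
  from cubic_solution_minus[of "dom5 c" c, OF this] show ?thesis
    unfolding u_normal_form add_0_right mult_zero_left by (simp add: dom5_def)
qed

lemma u6_solution: "radial_heat_solution (5 / 2) k 2 (dom6 c) (u6 k s c)"
proof -
  have "continuous_on {z. 0 < snd z} (\<lambda>z. (\<lambda>t r. 15 * (t + c) + r\<^sup>2) (fst z) (snd z))"
    by (intro continuous_intros)
  from open_continuous_preimage_halfplane[OF _ this, of "- {0}"]
  have "open (dom6 c)" by (simp add: dom6_def open_Compl)
  from cubic_solution_plus[of "dom6 c" c 0, OF this] show ?thesis
    unfolding u_normal_form add_0_right mult_zero_left by (simp add: dom6_def)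
qed

text \<open>
  The double root of the quadratic \<open>G\<close> is \<open>v = \<sigma>\<close>, and \<open>t\<close> drops out of the numerator of
  \<open>r u - \<sigma>\<close>, which is a multiple of \<open>r\<^sup>2\<close>. Its square therefore has the shape of \<open>u\<^sub>t\<close>: a power of \<open>r\<close>
  over the square of the denominator of \<open>u\<close>.
\<close>

lemma u5_arises: "arises_from 2 (dom5 c) (u5 k s c) (G5 k s) (H5 k s)"
proof (rule arises_from_two_I)
  fix t r assume "(t, r) \<in> dom5 c"
  then have r: "0 < r" "3 * (t + c) + r\<^sup>2 \<noteq> 0" by (simp_all add: dom5_def)
  then show "0 < r" by simp
  define y where "y = 3 * (t + c) + r\<^sup>2"
  have y: "y \<noteq> 0" using r(2) by (simp add: y_def)
  have v: "r * u5 k s c t r - \<sigma> = - 4 * \<sigma> * r\<^sup>2 / y"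
  proof -
    have "r * u5 k s c t r = \<sigma> * (3 * (t + c - r\<^sup>2)) / y"
      using r(1) by (simp add: u_normal_form y_def)
    also have "3 * (t + c - r\<^sup>2) = y - 4 * r\<^sup>2" by (simp add: y_def)
    finally show ?thesis using y by (simp add: field_simps)
  qed
  have G: "G5 k s x (r * u5 k s c t r) = 12 * \<sigma> * r ^ 4 / y\<^sup>2" for x
    unfolding GH_normal_form v using amplitude(3)
    by (simp add: field_simps power2_eq_square power4_eq_xxxx)
  have dt: "((\<lambda>t'. u5 k s c t' r) has_real_derivative 12 * \<sigma> * r / y\<^sup>2) (at t)"
    unfolding u_normal_form y_def using r
    by (auto intro!: derivative_eq_intros) (simp add: divide_simps, simp add: algebra_simps power2_eq_square)
  show "((\<lambda>t'. u5 k s c t' r) has_real_derivative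
      G5 k s (t / r\<^sup>2) (r * u5 k s c t r) / r ^ 3) (at t)"
    unfolding G using r by (intro DERIV_cong[OF dt]) (simp add: power4_eq_xxxx power3_eq_cube)
  show "((\<lambda>r'. u5 k s c t r') has_real_derivative
      H5 k s (t / r\<^sup>2) (r * u5 k s c t r) / r\<^sup>2) (at r)"
    unfolding GH_normal_form(4) G unfolding u_normal_form y_def using r
    by (auto intro!: derivative_eq_intros)
      (simp add: divide_simps, simp add: algebra_simps eval_nat_numeral)
qed

text \<open>
  As for \<open>u5\<close>, the numerator of \<open>r u - \<sigma>\<close> is a multiple of \<open>r\<^sup>2\<close>.
\<close>

lemma u6_arises: "arises_from 2 (dom6 c) (u6 k s c) (G6 k (- s)) (H6 k (- s))"
proof (rule arises_from_two_I)
  fix t r assume "(t, r) \<in> dom6 c"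
  then have r: "0 < r" "15 * (t + c) + r\<^sup>2 \<noteq> 0" by (simp_all add: dom6_def)
  then show "0 < r" by simp
  define y where "y = 15 * (t + c) + r\<^sup>2"
  have y: "y \<noteq> 0" using r(2) by (simp add: y_def)
  have v: "r * u6 k s c t r - \<sigma> =  4 * \<sigma> * r\<^sup>2 / y"
  proof -
    have "r * u6 k s c t r = \<sigma> * (5 * (3 * (t + c) + r\<^sup>2)) / y"
      using r(1) by (simp add: u_normal_form y_def)
    also have "5 * (3 * (t + c) + r\<^sup>2) = y + 4 * r\<^sup>2" by (simp add: y_def)
    finally show ?thesis using y by (simp add: field_simps)
  qed
  have G: "G6 k (- s) x (r * u6 k s c t r) = - 60 * \<sigma> * r ^ 4 / y\<^sup>2" for x
    unfolding GH_normal_form v using amplitude(3)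
    by (simp add: field_simps power2_eq_square power4_eq_xxxx)
  have dt: "((\<lambda>t'. u6 k s c t' r) has_real_derivative - 60 * \<sigma> * r / y\<^sup>2) (at t)"
    unfolding u_normal_form y_def using r
    by (auto intro!: derivative_eq_intros) (simp add: divide_simps, simp add: algebra_simps power2_eq_square)
  show "((\<lambda>t'. u6 k s c t' r) has_real_derivative
      G6 k (- s) (t / r\<^sup>2) (r * u6 k s c t r) / r ^ 3) (at t)"
    unfolding G using r by (intro DERIV_cong[OF dt]) (simp add: power4_eq_xxxx power3_eq_cube)
  show "((\<lambda>r'. u6 k s c t r') has_real_derivative
      H6 k (- s) (t / r\<^sup>2) (r * u6 k s c t r) / r\<^sup>2) (at r)"
    unfolding GH_normal_form(6) G unfolding u_normal_form y_def using r
    by (auto intro!: derivative_eq_intros)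
      (simp add: divide_simps, simp add: algebra_simps eval_nat_numeral)
qed

text \<open>
  With \<open>M\<close> the denominator of \<open>u\<close>, the constant \<open>c\<close> and the root of \<open>r\<close> occur in the derivatives
  only through \<open>M\<close>, since \<open>M\<^sub>r = (5 r y + M) / (2 r)\<close>.
\<close>

lemma u4_arises:
  "arises_from 2 (dom4 c \<inter> {(t, r). 3 * (t / r\<^sup>2) + 1 \<noteq> 0}) (u4 k s c) (G4 k (- s)) (H4 k (- s))"
proof (rule arises_from_two_I)
  fix t r assume z: "(t, r) \<in> dom4 c \<inter> {(t, r). 3 * (t / r\<^sup>2) + 1 \<noteq> 0}"
  define M where "M = r * (15 * t + r\<^sup>2) + c * sqrt r"
  define y where "y = 3 * t + r\<^sup>2"
  from z have r: "0 < r" and M: "M \<noteq> 0" by (auto simp: dom4_def M_def)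
  then show "0 < r" by simp
  have x: "3 * (t / r\<^sup>2) + 1 = y / r\<^sup>2" "3 * (t / r\<^sup>2) - 1 = (3 * t - r\<^sup>2) / r\<^sup>2"
    using r by (simp_all add: y_def field_simps)
  have "3 * (t / r\<^sup>2) + 1 \<noteq> 0" using z by simp
  then have y: "y \<noteq> 0" unfolding x by auto
  have u: "u4 k s c t r = 5 * \<sigma> * y / M"
    by (simp add: u_normal_form y_def M_def)
  have G: "G4 k (- s) (t / r\<^sup>2) (r * u4 k s c t r) = 15 * \<sigma> * r ^ 3 * (M - 5 * r * y) / M\<^sup>2"
    unfolding GH_normal_form(1) x u using r M y amplitude(3)
    by (simp add: field_simps power2_eq_square power3_eq_cube)
  have dMt: "((\<lambda>t'. r * (15 * t' + r\<^sup>2) + c * sqrt r) has_real_derivative 15 * r) (at t)"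
    by (auto intro!: derivative_eq_intros)
  have dMr: "((\<lambda>r'. r' * (15 * t + r'\<^sup>2) + c * sqrt r') has_real_derivative
      (5 * r * y + M) / (2 * r)) (at r)"
  proof -
    have "((\<lambda>r'. r' * (15 * t + r'\<^sup>2) + sqrt r' * c) has_real_derivative
        (15 * t + 3 * r\<^sup>2) + sqrt r * (0 + c / (2 * r))) (at r)"
      by (intro DERIV_add DERIV_sqrt_mult r DERIV_const)
        (auto intro!: derivative_eq_intros simp: power2_eq_square)
    then show ?thesis
      using r by (simp add: M_def y_def field_simps power2_eq_square)
  qed
  have dNt: "((\<lambda>t'. \<sigma> * (5 * (3 * t' + r\<^sup>2))) has_real_derivative 15 * \<sigma>) (at t)"
    and dNr: "((\<lambda>r'. \<sigma> * (5 * (3 * t + r'\<^sup>2))) has_real_derivative 10 * \<sigma> * r) (at r)"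
    by (auto intro!: derivative_eq_intros)
  show "((\<lambda>t'. u4 k s c t' r) has_real_derivative
      G4 k (- s) (t / r\<^sup>2) (r * u4 k s c t r) / r ^ 3) (at t)"
    unfolding G unfolding u_normal_form
    by (rule DERIV_cong[OF DERIV_divide[OF dNt dMt]])
      (use r M in \<open>simp_all add: M_def[symmetric] y_def[symmetric]\<close>,
       simp add: field_simps power2_eq_square)
  show "((\<lambda>r'. u4 k s c t r') has_real_derivative
      H4 k (- s) (t / r\<^sup>2) (r * u4 k s c t r) / r\<^sup>2) (at r)"
    unfolding GH_normal_form(2) G unfolding x u unfolding u_normal_form
  proof (rule DERIV_cong[OF DERIV_divide[OF dNr dMr]])
    show "r * (15 * t + r\<^sup>2) + c * sqrt r \<noteq> 0" using M by (simp add: M_def)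
    have t: "3 * t - r\<^sup>2 = y - 2 * r\<^sup>2" by (simp add: y_def)
    show "(10 * \<sigma> * r * (r * (15 * t + r\<^sup>2) + c * sqrt r) -
        \<sigma> * (5 * (3 * t + r\<^sup>2)) * ((5 * r * y + M) / (2 * r))) /
        ((r * (15 * t + r\<^sup>2) + c * sqrt r) * (r * (15 * t + r\<^sup>2) + c * sqrt r)) =
      (1 / 6 * (y / r\<^sup>2) * (15 * \<sigma> * r ^ 3 * (M - 5 * r * y) / M\<^sup>2) -
        (3 * t - r\<^sup>2) / r\<^sup>2 / (y / r\<^sup>2) * (r * (5 * \<sigma> * y / M))) / r\<^sup>2"
      unfolding M_def[symmetric] y_def[symmetric] t using r M y
      by (simp add: divide_simps) (simp add: algebra_simps power2_eq_square power3_eq_cube)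
  qed
qed

end

theorem theorem1:
  fixes n k q :: real
  assumes "n \<noteq> 1" and "k \<noteq> 0" and "q \<noteq> 0"
  shows
    "(\<forall>c. radial_heat_solution n k q (dom1 k q c) (u1 k q c) \<and>
          arises_from q (dom1 k q c) (u1 k q c) (G1 k q) H1)
   \<and> (q = 2 / (2 - n) \<and> q \<noteq> - 1 \<and> n \<noteq> 2 \<and> n \<noteq> 3 \<and> n \<noteq> 4 \<and> - k / ((n - 2) * (n - 3)) \<ge> 0 \<longrightarrow>
        (\<forall>c. \<forall>s\<in>{1, - 1}.
          radial_heat_solution n k q (dom2 n k q s c) (u2 n k s c) \<and>
          (\<forall>D. D \<subseteq> dom2 n k q s c \<and> connected D \<longrightarrow>
             (\<exists>s'\<in>{1, - 1}. arises_from q D (u2 n k s c) (G2 n k s') (H2 n k s')))))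
   \<and> (q = - 4 \<and> n = 5 / 2 \<and> k \<ge> 0 \<longrightarrow>
        (\<forall>c. \<forall>s\<in>{1, - 1}.
          radial_heat_solution n k q (dom3 k q s c) (u3 k s c) \<and>
          (\<exists>s'\<in>{1, - 1}. arises_from q (dom3 k q s c) (u3 k s c) (G3 k s') (H3 k s'))))
   \<and> (q = 2 \<and> n = 5 / 2 \<and> - 2 * k \<ge> 0 \<longrightarrow>
        (\<forall>c. \<forall>s\<in>{1, - 1}.
          radial_heat_solution n k q (dom4 c) (u4 k s c) \<and>
          (\<exists>s'\<in>{1, - 1}. arises_from q (dom4 c \<inter> {(t, r). 3 * (t / r\<^sup>2) + 1 \<noteq> 0})
             (u4 k s c) (G4 k s') (H4 k s'))))
   \<and> (q = 2 \<and> n = 5 / 2 \<and> - 2 * k \<ge> 0 \<longrightarrow>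
        (\<forall>c. \<forall>s\<in>{1, - 1}.
          radial_heat_solution n k q (dom5 c) (u5 k s c) \<and>
          (\<exists>s'\<in>{1, - 1}. arises_from q (dom5 c) (u5 k s c) (G5 k s') (H5 k s'))))
   \<and> (q = 2 \<and> n = 5 / 2 \<and> - 2 * k \<ge> 0 \<longrightarrow>
        (\<forall>c. \<forall>s\<in>{1, - 1}.
          radial_heat_solution n k q (dom6 c) (u6 k s c) \<and>
          (\<exists>s'\<in>{1, - 1}. arises_from q (dom6 c) (u6 k s c) (G6 k s') (H6 k s'))))"
proof (intro conjI impI allI ballI)
  fix c
  show "radial_heat_solution n k q (dom1 k q c) (u1 k q c)"
    and "arises_from q (dom1 k q c) (u1 k q c) (G1 k q) H1"
    using assms(3) by (rule u1_solution, rule u1_arises)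
next
  fix c s :: real
  assume "q = 2 / (2 - n) \<and> q \<noteq> - 1 \<and> n \<noteq> 2 \<and> n \<noteq> 3 \<and> n \<noteq> 4 \<and> - k / ((n - 2) * (n - 3)) \<ge> 0"
    and s: "s \<in> {1, - 1}"
  then have h: "q = 2 / (2 - n)" "n \<noteq> 1" "n \<noteq> 2" "n \<noteq> 3" "n \<noteq> 4" "k \<noteq> 0"
      "- k / ((n - 2) * (n - 3)) \<ge> 0"
    using assms by simp_all
  show "radial_heat_solution n k q (dom2 n k q s c) (u2 n k s c)"
    by (rule u2_solution[OF h s])
  fix D assume "D \<subseteq> dom2 n k q s c \<and> connected D"
  then show "\<exists>s'\<in>{1, - 1}. arises_from q D (u2 n k s c) (G2 n k s') (H2 n k s')"
    using u2_arises[OF h s] by blast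
next
  fix c s :: real
  assume "q = - 4 \<and> n = 5 / 2 \<and> k \<ge> 0" and s: "s \<in> {1, - 1}"
  then have q: "q = - 4" "n = 5 / 2" and k: "0 < k" using assms(2) by simp_all
  note sol = u3_solution_arises[OF k s, of c]
  show "radial_heat_solution n k q (dom3 k q s c) (u3 k s c)"
    unfolding q by (rule sol(1))
  show "\<exists>s'\<in>{1, - 1}. arises_from q (dom3 k q s c) (u3 k s c) (G3 k s') (H3 k s')"
    unfolding q using sol(2) s by (intro bexI[of _ "- s"]) auto
next
  fix c s :: real
  assume "q = 2 \<and> n = 5 / 2 \<and> - 2 * k \<ge> 0" and s: "s \<in> {1, - 1}"
  then have q: "q = 2" "n = 5 / 2" and k: "k < 0" using assms(2) by simp_all
  show "radial_heat_solution n k q (dom4 c) (u4 k s c)"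
    unfolding q by (rule u4_solution[OF k s])
  show "\<exists>s'\<in>{1, - 1}. arises_from q (dom4 c \<inter> {(t, r). 3 * (t / r\<^sup>2) + 1 \<noteq> 0})
      (u4 k s c) (G4 k s') (H4 k s')"
    unfolding q using u4_arises[OF k s] s by (intro bexI[of _ "- s"]) auto
next
  fix c s :: real
  assume "q = 2 \<and> n = 5 / 2 \<and> - 2 * k \<ge> 0" and s: "s \<in> {1, - 1}"
  then have q: "q = 2" "n = 5 / 2" and k: "k < 0" using assms(2) by simp_all
  show "radial_heat_solution n k q (dom5 c) (u5 k s c)"
    unfolding q by (rule u5_solution[OF k s])
  show "\<exists>s'\<in>{1, - 1}. arises_from q (dom5 c) (u5 k s c) (G5 k s') (H5 k s')"
    unfolding q using u5_arises[OF k s] s by blast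
next
  fix c s :: real
  assume "q = 2 \<and> n = 5 / 2 \<and> - 2 * k \<ge> 0" and s: "s \<in> {1, - 1}"
  then have q: "q = 2" "n = 5 / 2" and k: "k < 0" using assms(2) by simp_all
  show "radial_heat_solution n k q (dom6 c) (u6 k s c)"
    unfolding q by (rule u6_solution[OF k s])
  show "\<exists>s'\<in>{1, - 1}. arises_from q (dom6 c) (u6 k s c) (G6 k s') (H6 k s')"
    unfolding q using u6_arises[OF k s] s by (intro bexI[of _ "- s"]) auto
qed

end
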